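(* Assume Schanuel's Conjecture. Let $p(x,y,z)\in\overline{\mathbb{Q}}[x,y,z]$ be irreducible, depending on $x$ and on $z$, and not of the form $c\,y^{m}z^{l}$ with $c\in\mathbb{C}$, $m,l\in\mathbb{N}$. Then there exists $a\in\mathbb{C}$ such that $p(a,e^a,e^{e^a})=0$ and $\operatorname{td}_{\mathbb{Q}}(a,e^a,e^{e^a})=2$.
   Context: $\overline{\mathbb{Q}}$ is the field of algebraic numbers and $\operatorname{td}_{\mathbb{Q}}$ denotes transcendence degree over $\mathbb{Q}$. Schanuel's Conjecture: if $\lambda_1,\dots,\lambda_n\in\mathbb{C}$ are linearly independent over $\mathbb{Q}$, then $\operatorname{td}_{\mathbb{Q}}\mathbb{Q}(\lambda_1,\dots,\lambda_n,e^{\lambda_1},\dots,e^{\lambda_n})\ge n$. *)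

theory Defs
  imports
    "HOL-Analysis.Analysis"
    "HOL-Computational_Algebra.Computational_Algebra"
    "HOL-Library.Poly_Mapping"
    "HOL-Library.Extended_Nat"
begin

section \<open>The complex numbers as a rational vector space\<close>

interpretation rat_vs: vector_space "\<lambda>(q::rat) (z::complex). of_rat q * z"
  by unfold_locales (simp_all add: algebra_simps of_rat_add of_rat_mult)


section \<open>The field of algebraic numbers\<close>

lemma algebraic_if_powers_in_span:
  fixes z :: complex
  assumes "finite W" and span: "\<And>k. z ^ k \<in> rat_vs.span W"
  shows "algebraic z"
proof (cases "inj_on (\<lambda>k. z ^ k) {..card W}")
  case False
  then obtain a b :: nat where ab: "a \<noteq> b" "z ^ a = z ^ b"
    by (auto simp: inj_on_def)
  show ?thesis
  proof (rule algebraicI)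
    show "coeff (monom 1 a - monom 1 b :: complex poly) i \<in> \<int>" for i
      by (auto simp: coeff_monom)
    have "coeff (monom 1 a - monom 1 b :: complex poly) a \<noteq> 0"
      using ab by simp
    then show "monom 1 a - monom 1 b \<noteq> (0 :: complex poly)"
      by (metis coeff_0)
    show "poly (monom 1 a - monom 1 b) z = 0"
      using ab by (simp add: poly_monom)
  qed
next
  case True
  let ?P = "(\<lambda>k. z ^ k) ` {..card W}"
  have "?P \<subseteq> rat_vs.span W"
    using span by auto
  moreover have "card ?P > card W"
    using True by (simp add: card_image)
  ultimately have "rat_vs.dependent ?P"
    using rat_vs.independent_span_bound[OF \<open>finite W\<close>, of ?P] by linarith
  then obtain u v where u: "(\<Sum>v\<in>?P. of_rat (u v) * v) = 0" "v \<in> ?P" "u v \<noteq> 0"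
    by (subst (asm) rat_vs.dependent_finite) auto
  define p where "p = (\<Sum>k\<le>card W. monom (of_rat (u (z ^ k)) :: complex) k)"
  have coeff: "coeff p i = (if i \<le> card W then of_rat (u (z ^ i)) else 0)" for i
    by (auto simp: p_def coeff_sum coeff_monom if_distrib cong: if_cong)
  show ?thesis
  proof (rule algebraicI')
    show "coeff p i \<in> \<rat>" for i
      by (simp add: coeff)
    obtain k where "k \<le> card W" "v = z ^ k"
      using u(2) by auto
    then have "coeff p k \<noteq> 0"
      using u(3) by (simp add: coeff)
    then show "p \<noteq> 0"
      by auto
    have "poly p z = (\<Sum>k\<le>card W. of_rat (u (z ^ k)) * z ^ k)"
      by (simp add: p_def poly_sum poly_monom)
    also have "\<dots> = (\<Sum>v\<in>?P. of_rat (u v) * v)"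
      by (subst sum.reindex[OF True]) simp
    finally show "poly p z = 0"
      using u(1) by simp
  qed
qed

lemma algebraic_powers_in_span:
  fixes x :: complex
  assumes "algebraic x"
  obtains n where "\<And>k. x ^ k \<in> rat_vs.span ((\<lambda>i. x ^ i) ` {..<n})"
proof -
  obtain p where p: "\<And>i. coeff p i \<in> \<rat>" "p \<noteq> 0" "poly p x = 0"
    using assms by (auto simp: algebraic_altdef)
  define n where "n = degree p"
  define V where "V = rat_vs.span ((\<lambda>i. x ^ i) ` {..<n})"
  have scale: "c * v \<in> V" if "c \<in> \<rat>" "v \<in> V" for c v
    using that rat_vs.span_scale unfolding V_def by (auto elim!: Rats_cases)
  have "x ^ k \<in> V" for k
  proof (induction k rule: less_induct)
    case (less k)
    show ?case
    proof (cases "k < n")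
      case True
      then show ?thesis
        unfolding V_def by (intro rat_vs.span_base) auto
    next
      case False
      define c where "c = lead_coeff p"
      have c: "c \<noteq> 0" "c \<in> \<rat>"
        using p by (auto simp: c_def)
      have "(\<Sum>i<n. coeff p i * x ^ i) + c * x ^ n = 0"
        using p(3) by (simp add: poly_altdef n_def c_def lessThan_Suc_atMost[symmetric])
      then have "x ^ n = (- 1 / c) * (\<Sum>i<n. coeff p i * x ^ i)"
        using c by (simp add: field_simps add_eq_0_iff)
      moreover have "x ^ k = x ^ n * x ^ (k - n)"
        using False by (simp flip: power_add)
      ultimately have "x ^ k = (- 1 / c) * (\<Sum>i<n. coeff p i * x ^ (i + (k - n)))"
        by (simp only: sum_distrib_right power_add mult.assoc)
      moreover have "(\<Sum>i<n. coeff p i * x ^ (i + (k - n))) \<in> V"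
        unfolding V_def
      proof (rule rat_vs.span_sum)
        fix i assume "i \<in> {..<n}"
        then have "x ^ (i + (k - n)) \<in> V"
          using False by (intro less) auto
        then show "coeff p i * x ^ (i + (k - n)) \<in> rat_vs.span ((\<lambda>i. x ^ i) ` {..<n})"
          using scale p(1) by (simp flip: V_def)
      qed
      ultimately show ?thesis
        using scale[of "- 1 / c"] c by simp
    qed
  qed
  then show ?thesis
    using that unfolding V_def by blast
qed

lemma span_mult_mem:
  assumes "x \<in> rat_vs.span A" "y \<in> rat_vs.span B"
  shows "x * y \<in> rat_vs.span ((\<lambda>(a, b). a * b) ` (A \<times> B))" (is "_ \<in> ?S")
proof -
  have 1: "a * y \<in> ?S" if "a \<in> A" for a
    using assms(2)
  proof (induction rule: rat_vs.span_induct_alt)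
    case base
    show ?case by (simp add: rat_vs.span_zero)
  next
    case (step c b y)
    have "a * b \<in> ?S"
      using that step by (intro rat_vs.span_base) auto
    then have "of_rat c * (a * b) + a * y \<in> ?S"
      using step by (intro rat_vs.span_add rat_vs.span_scale)
    then show ?case by (simp add: algebra_simps)
  qed
  show ?thesis
    using assms(1)
  proof (induction rule: rat_vs.span_induct_alt)
    case base
    show ?case by (simp add: rat_vs.span_zero)
  next
    case (step c a x)
    then have "of_rat c * (a * y) + x * y \<in> ?S"
      by (intro rat_vs.span_add rat_vs.span_scale 1[OF step(1)])
    then show ?case by (simp add: algebra_simps)
  qed
qed

lemma algebraic_add_and_mult:
  fixes x y :: complex
  assumes "algebraic x" "algebraic y"
  shows algebraic_add: "algebraic (x + y)" and algebraic_mult: "algebraic (x * y)"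
proof -
  obtain n where n: "\<And>k. x ^ k \<in> rat_vs.span ((\<lambda>i. x ^ i) ` {..<n})"
    using algebraic_powers_in_span[OF assms(1)] by blast
  obtain m where m: "\<And>k. y ^ k \<in> rat_vs.span ((\<lambda>i. y ^ i) ` {..<m})"
    using algebraic_powers_in_span[OF assms(2)] by blast
  define W where "W = (\<lambda>(a, b). a * b) ` ((\<lambda>i. x ^ i) ` {..<n} \<times> (\<lambda>i. y ^ i) ` {..<m})"
  have "finite W"
    by (simp add: W_def)
  have W: "x ^ i * y ^ j \<in> rat_vs.span W" for i j
    unfolding W_def by (rule span_mult_mem[OF n m])
  show "algebraic (x * y)"
    by (rule algebraic_if_powers_in_span[OF \<open>finite W\<close>]) (use W in \<open>simp add: power_mult_distrib\<close>)
  show "algebraic (x + y)"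
  proof (rule algebraic_if_powers_in_span[OF \<open>finite W\<close>])
    fix k
    have "(x + y) ^ k = (\<Sum>i\<le>k. of_rat (of_nat (k choose i)) * (x ^ i * y ^ (k - i)))"
      by (simp add: binomial_ring mult_ac)
    also have "\<dots> \<in> rat_vs.span W"
      by (intro rat_vs.span_sum rat_vs.span_scale W)
    finally show "(x + y) ^ k \<in> rat_vs.span W" .
  qed
qed

typedef qbar = "{z::complex. algebraic z}"
  morphisms complex_of_qbar Abs_qbar
  by (rule exI[of _ 0]) simp

setup_lifting type_definition_qbar

instantiation qbar :: field
begin

lift_definition zero_qbar :: qbar is 0 by simp
lift_definition one_qbar :: qbar is 1 by simp
lift_definition plus_qbar :: "qbar \<Rightarrow> qbar \<Rightarrow> qbar" is "(+)" by (rule algebraic_add)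
lift_definition uminus_qbar :: "qbar \<Rightarrow> qbar" is uminus by simp
lift_definition minus_qbar :: "qbar \<Rightarrow> qbar \<Rightarrow> qbar" is "(-)"
  by (metis algebraic_add algebraic_minus_iff diff_conv_add_uminus)
lift_definition times_qbar :: "qbar \<Rightarrow> qbar \<Rightarrow> qbar" is "(*)" by (rule algebraic_mult)
lift_definition inverse_qbar :: "qbar \<Rightarrow> qbar" is inverse by (rule algebraic_inverse)
lift_definition divide_qbar :: "qbar \<Rightarrow> qbar \<Rightarrow> qbar" is "(/)"
  by (simp add: divide_inverse algebraic_mult algebraic_inverse)

instance
  by standard (transfer; simp add: field_simps)+

end


section \<open>Transcendence degree over the rationals\<close>

definition rat_adjoin :: "complex set \<Rightarrow> complex set" where
  "rat_adjoin S = \<Inter> {K. S \<subseteq> K \<and> 0 \<in> K \<and> 1 \<in> K \<and>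
     (\<forall>x\<in>K. \<forall>y\<in>K. x - y \<in> K \<and> x * y \<in> K) \<and> (\<forall>x\<in>K. inverse x \<in> K)}"

text \<open>
  A polynomial with rational coefficients has one variable for each complex number; a monomial
  is the finitely supported function giving the exponents. It is evaluated by
  substituting \<open>b\<close> for the variable indexed by \<open>b\<close>.
\<close>

definition tautological_eval :: "((complex \<Rightarrow>\<^sub>0 nat) \<Rightarrow>\<^sub>0 rat) \<Rightarrow> complex" where
  "tautological_eval P =
     (\<Sum>m\<in>Poly_Mapping.keys P. of_rat (Poly_Mapping.lookup P m) *
        (\<Prod>b\<in>Poly_Mapping.keys m. b ^ Poly_Mapping.lookup m b))"

definition alg_independent :: "complex set \<Rightarrow> bool" where
  "alg_independent B \<longleftrightarrow>
     (\<forall>P. (\<forall>m\<in>Poly_Mapping.keys P. Poly_Mapping.keys m \<subseteq> B) \<and> tautological_eval P = 0 \<longrightarrow> P = 0)"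

text \<open>
  The transcendence degree of a field \<open>K\<close> is the largest cardinality of an algebraically
  independent subset of \<open>K\<close>, with value \<open>\<infinity>\<close> if these cardinalities are unbounded.
\<close>

definition trdeg_rat :: "complex set \<Rightarrow> enat" where
  "trdeg_rat K = (SUP B\<in>{B. finite B \<and> B \<subseteq> K \<and> alg_independent B}. enat (card B))"


section \<open>Schanuel's Conjecture\<close>

text \<open>Linear independence of the family \<open>l 0, \<dots>, l (n - 1)\<close> is injectivity of \<open>l\<close> together
  with linear independence of the set of its values.\<close>

definition Schanuel_Conjecture :: bool where
  "Schanuel_Conjecture \<longleftrightarrow>
     (\<forall>(n::nat) (l :: nat \<Rightarrow> complex).
        inj_on l {..<n} \<and> rat_vs.independent (l ` {..<n}) \<longrightarrow>
        enat n \<le> trdeg_rat (rat_adjoin (l ` {..<n} \<union> (\<lambda>i. exp (l i)) ` {..<n})))"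


section \<open>Polynomials in three variables\<close>

text \<open>
  Iterated univariate polynomials represent \<open>R[x][y][z]\<close>: the innermost variable is \<open>x\<close> and
  the outermost is \<open>z\<close>, so \<open>coeff (coeff (coeff p l) m) k\<close> is the coefficient of
  \<open>x\<^sup>k y\<^sup>m z\<^sup>l\<close>.
\<close>

definition depends_on_x :: "'a::zero poly poly poly \<Rightarrow> bool" where
  "depends_on_x p \<longleftrightarrow> (\<exists>l m. degree (coeff (coeff p l) m) > 0)"

definition depends_on_z :: "'a::zero poly poly poly \<Rightarrow> bool" where
  "depends_on_z p \<longleftrightarrow> degree p > 0"

definition complex_poly3 :: "qbar poly poly poly \<Rightarrow> complex poly poly poly" where
  "complex_poly3 = map_poly (map_poly (map_poly complex_of_qbar))"

definition eval3 :: "'a::comm_semiring_1 poly poly poly \<Rightarrow> 'a \<Rightarrow> 'a \<Rightarrow> 'a \<Rightarrow> 'a" where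
  "eval3 p a b c = poly (poly (poly p [:[:c:]:]) [:b:]) a"

end

theory Submission
  imports Defs "HOL-Complex_Analysis.Complex_Analysis"
begin

text \<open>
  A zero \<open>a\<close> of \<open>p(x, exp x, exp (exp x))\<close> for which \<open>a\<close> and \<open>exp a\<close> are linearly independent over
  the rationals is generic: Schanuel's Conjecture gives transcendence degree at least 2, and \<open>p\<close>
  itself gives at most 2. If \<open>exp a = q a\<close> with \<open>q = m / n\<close> rational in lowest terms, then
  \<open>exp (exp a)\<close> is an \<open>n\<close>-th root of \<open>(q a) ^ m\<close>, hence of degree \<open>n\<close> over the rational functions
  in \<open>a\<close>, which forces \<open>n\<close> to be at most the \<open>z\<close>-degree of \<open>p\<close> and bounds \<open>\<bar>q\<bar>\<close> from below.
  So it is enough to find zeros \<open>a\<close> for which \<open>exp a\<close> is much smaller than \<open>a\<close>.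

  These are found at \<open>y = 2 \<pi> \<i> N + \<sigma> ln N + t\<close>, \<open>x = Ln y + 2 \<pi> \<i> N ^ r\<close>, where \<open>exp x = y\<close> and
  \<open>exp y = N powr \<sigma> * exp t\<close>. For large \<open>r\<close> and \<open>\<sigma>\<close> the slope of an edge of a Newton polygon
  of \<open>p\<close>, the function \<open>p(x, y, exp y)\<close>, suitably normalised, converges as \<open>N\<close> grows to
  an exponential polynomial in \<open>t\<close> with at least two terms. The latter has a zero, and Hurwitz's
  theorem provides zeros for finite \<open>N\<close>.
\<close>

section \<open>Zeros at which the exponential is small\<close>

text \<open>A line through the highest of the leftmost points \<open>(L s, W s)\<close> is tilted
  until it rests on a further point from above. \<open>g s\<close> is minus the slope from that
  point \<open>s0\<close> to \<open>s\<close>, so its minimiser gives the edge.\<close>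

lemma newton_edge:
  fixes W :: "'a \<Rightarrow> real" and L :: "'a \<Rightarrow> nat"
  assumes "finite S" "s1 \<in> S" "s2 \<in> S" "L s1 \<noteq> L s2"
  obtains \<sigma> A s s' where "\<And>s. s \<in> S \<Longrightarrow> W s + (\<sigma>::real) * real (L s) \<le> A" "s \<in> S" "s' \<in> S" "L s \<noteq> L s'"
    "W s + \<sigma> * real (L s) = A" "W s' + \<sigma> * real (L s') = A"
proof -
  define l0 where "l0 = Min (L ` S)"
  have l0: "l0 \<in> L ` S" "\<And>s. s \<in> S \<Longrightarrow> l0 \<le> L s"
    using assms by (auto simp: l0_def intro!: Min_in)
  define S0 where "S0 = {s \<in> S. L s = l0}"
  define S1 where "S1 = {s \<in> S. l0 < L s}"
  have "finite S0" "S0 \<noteq> {}" "finite S1"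
    using l0 assms(1) by (auto simp: S0_def S1_def)
  have "S1 \<noteq> {}"
    using assms l0(2)[of s1] l0(2)[of s2] by (cases "L s1 = l0") (auto simp: S1_def)
  obtain s0 where s0: "s0 \<in> S0" "\<And>s. s \<in> S0 \<Longrightarrow> W s \<le> W s0"
    using arg_min_if_finite[OF \<open>finite S0\<close> \<open>S0 \<noteq> {}\<close>, of "\<lambda>s. - W s"] by (meson neg_less_iff_less not_le)
  define g where "g = (\<lambda>s. (W s0 - W s) / (real (L s) - real l0))"
  obtain s3 where s3: "s3 \<in> S1" "\<And>s. s \<in> S1 \<Longrightarrow> g s3 \<le> g s"
    using arg_min_if_finite[OF \<open>finite S1\<close> \<open>S1 \<noteq> {}\<close>, of g] by (meson not_le)
  have s3l: "l0 < L s3" "s3 \<in> S" and s0l: "L s0 = l0" "s0 \<in> S"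
    using s3 s0 by (auto simp: S1_def S0_def)
  show ?thesis
  proof (rule that[of "g s3" "W s0 + g s3 * l0" s0 s3])
    show "W s + g s3 * L s \<le> W s0 + g s3 * l0" if "s \<in> S" for s
    proof (cases "L s = l0")
      case True
      then show ?thesis using s0(2)[of s] that by (simp add: S0_def)
    next
      case False
      then have lt: "l0 < L s" using l0(2)[OF that] by simp
      then have "g s3 \<le> g s" using s3 that by (auto simp: S1_def)
      then have "g s3 * (real (L s) - real l0) \<le> W s0 - W s"
        using lt by (simp add: g_def field_simps)
      then show ?thesis by (simp add: algebra_simps)
    qed
    show "W s3 + g s3 * L s3 = W s0 + g s3 * l0"
    proof -
      have "g s3 * (real (L s3) - real l0) = W s0 - W s3"
        using s3l by (simp add: g_def)
      then show ?thesis by (simp add: algebra_simps)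
    qed
  qed (use s3l s0l in auto)
qed

text \<open>Dividing out the full power of the variable leaves a factor that is nonzero at 0. Two
  distinct exponents in \<open>Q\<close> keep that factor from being constant, so it has a
  root.\<close>

lemma poly_nonzero_root:
  fixes Q :: "complex poly"
  assumes "coeff Q i \<noteq> 0" "coeff Q j \<noteq> 0" "i \<noteq> j"
  obtains v where "v \<noteq> 0" "poly Q v = 0"
proof -
  have "Q \<noteq> 0" using assms by auto
  then obtain R where R: "Q = [:- 0, 1:] ^ order 0 Q * R" "\<not> [:- 0, 1:] dvd R"
    using order_decomp[of Q 0] by blast
  have R0: "poly R 0 \<noteq> 0"
    using R(2) by (simp add: poly_eq_0_iff_dvd)
  have Q: "Q = monom 1 (order 0 Q) * R"
    using R(1) by (simp add: monom_altdef)
  have "R \<noteq> [:c:]" for c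
  proof
    assume "R = [:c:]"
    then have "Q = monom c (order 0 Q)"
      using Q by (simp add: smult_monom)
    then show False
      using assms by (metis coeff_monom)
  qed
  then obtain v where "poly R v = 0"
    using fundamental_theorem_of_algebra_alt[of R] by auto
  then show ?thesis
    using R0 Q that[of v] by (metis mult_zero_right poly_mult)
qed

text \<open>In the variable \<open>exp t\<close> the sum is a polynomial, and injectivity of
  \<open>L\<close> keeps its terms from merging, so it has a nonzero root. Nonconstancy near the
  zero is what Hurwitz's theorem will require.\<close>

lemma exp_sum_zero:
  fixes \<gamma> :: "'a \<Rightarrow> complex" and L :: "'a \<Rightarrow> nat"
  assumes "finite S" "inj_on L S" "s1 \<in> S" "s2 \<in> S" "s1 \<noteq> s2" "\<And>s. s \<in> S \<Longrightarrow> \<gamma> s \<noteq> 0"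
  defines "G \<equiv> \<lambda>t. \<Sum>s\<in>S. \<gamma> s * exp (of_nat (L s) * t)"
  obtains t0 where "G t0 = 0" "\<not> G constant_on ball t0 1"
proof -
  define Q where "Q = (\<Sum>s\<in>S. monom (\<gamma> s) (L s))"
  have GQ: "G t = poly Q (exp t)" for t
    by (simp add: G_def Q_def poly_sum poly_monom exp_of_nat_mult)
  have co: "coeff Q (L s) = \<gamma> s" if "s \<in> S" for s
  proof -
    have "coeff Q (L s) = (\<Sum>u\<in>S. if u = s then \<gamma> u else 0)"
      unfolding Q_def coeff_sum using assms(2) that
      by (intro sum.cong refl) (auto simp: coeff_monom inj_on_def)
    then show ?thesis using that assms(1) by simp
  qed
  obtain v where v: "v \<noteq> 0" "poly Q v = 0"
    using poly_nonzero_root[of Q "L s1" "L s2"] co assms by (metis inj_onD)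
  show ?thesis
  proof (rule that[of "Ln v"])
    show G0: "G (Ln v) = 0" using v by (simp add: GQ)
    show "\<not> G constant_on ball (Ln v) 1"
    proof
      assume "G constant_on ball (Ln v) 1"
      then have z: "G t = 0" if "t \<in> ball (Ln v) 1" for t
        using G0 that by (metis constant_on_def centre_in_ball zero_less_one)
      have "Q \<noteq> 0" using co assms by fastforce
      then have "finite {w. poly Q w = 0}" by (rule poly_roots_finite)
      \<comment> \<open>Along a horizontal segment the modulus of \<open>exp\<close> varies, so a
        vanishing \<open>G\<close> would give \<open>Q\<close> infinitely many roots.\<close>
      moreover have "exp ` ((\<lambda>u. Ln v + complex_of_real u) ` {0..<1}) \<subseteq> {w. poly Q w = 0}"
        using z by (auto simp flip: GQ simp: dist_norm)
      moreover have "inj_on (\<lambda>u. exp (Ln v + complex_of_real u)) {0..<1}"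
        using v by (auto simp: inj_on_def exp_add exp_of_real simp del: of_real_exp)
      ultimately have "finite {0..<1::real}"
        by (metis finite_imageD finite_subset image_image)
      then show False by (simp add: infinite_Ico)
    qed
  qed
qed

section \<open>Uniform asymptotics along the curve\<close>

lemma uniform_lim_power:
  fixes f :: "'a \<Rightarrow> 'b \<Rightarrow> complex"
  assumes "uniform_limit S f (\<lambda>_. c) F"
  shows "uniform_limit S (\<lambda>n x. f n x ^ k) (\<lambda>_. c ^ k) F"
proof (induction k)
  case (Suc k)
  show ?case
    using uniform_lim_mult[OF assms Suc] by (simp add: bounded_subset[OF finite_imp_bounded] image_constant_conv)
qed (simp add: uniform_limit_const)

lemma uniform_lim_sum:
  fixes f :: "'a \<Rightarrow> 'b \<Rightarrow> 'c \<Rightarrow> complex"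
  assumes "\<And>i. i \<in> I \<Longrightarrow> uniform_limit S (f i) (g i) F"
  shows "uniform_limit S (\<lambda>n x. \<Sum>i\<in>I. f i n x) (\<lambda>x. \<Sum>i\<in>I. g i x) F"
  using assms
  by (induction I rule: infinite_finite_induct) (auto intro!: uniform_limit_intros)

lemma uniform_lim_bound:
  fixes f :: "'a \<Rightarrow> 'b \<Rightarrow> complex"
  assumes "eventually (\<lambda>n. \<forall>x\<in>S. norm (f n x - g x) \<le> h n) F" "(h \<longlongrightarrow> 0) F"
  shows "uniform_limit S f g F"
proof (rule uniform_limitI)
  fix e :: real assume "e > 0"
  then have "eventually (\<lambda>n. h n < e) F"
    using assms(2) by (simp add: order_tendsto_iff)
  with assms(1) show "\<forall>\<^sub>F n in F. \<forall>x\<in>S. dist (f n x) (g x) < e"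
    by eventually_elim (force simp: dist_norm)
qed

lemma cmod_Ln_le:
  assumes "z \<noteq> 0"
  shows "cmod (Ln z) \<le> \<bar>ln (cmod z)\<bar> + pi"
  using cmod_le[of "Ln z"] mpi_less_Im_Ln[OF assms] Im_Ln_le_pi[OF assms] Re_Ln[OF assms]
  by linarith

text \<open>Both limits follow from crude bounds: \<open>y\<close> differs from its main term by a
  logarithm and a bounded amount, and \<open>Ln y\<close> grows at most linearly, which is
  negligible against \<open>n ^ r\<close> because \<open>r\<close> is at least 2.\<close>

lemma exponential_curve_asymptotics:
  fixes \<sigma> R :: real and r :: nat and S :: "complex set"
    and x y :: "nat \<Rightarrow> complex \<Rightarrow> complex"
  assumes r: "2 \<le> r" and S: "\<And>t. t \<in> S \<Longrightarrow> cmod t \<le> R"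
  defines "y \<equiv> \<lambda>(n::nat) (t::complex). 2 * pi * \<i> * n + \<sigma> * of_real (ln n) + t"
  defines "x \<equiv> \<lambda>n t. Ln (y n t) + 2 * pi * \<i> * of_nat (n ^ r)"
  shows "uniform_limit S (\<lambda>n t. y n t / n) (\<lambda>_. 2 * pi * \<i>) sequentially"
    and "uniform_limit S (\<lambda>n t. x n t / of_nat n ^ r) (\<lambda>_. 2 * pi * \<i>) sequentially"
proof -
  have yb: "cmod (y n t - 2 * pi * \<i> * n) \<le> \<bar>\<sigma>\<bar> * ln n + \<bar>R\<bar>" if "n \<ge> 1" "t \<in> S" for n t
  proof -
    have "cmod (\<sigma> * ln n + t) \<le> cmod (of_real (\<sigma> * ln n)) + cmod t"
      by (metis norm_triangle_ineq of_real_mult)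
    also have "\<dots> \<le> \<bar>\<sigma>\<bar> * ln n + \<bar>R\<bar>"
      using that S[of t] by (simp add: norm_mult abs_mult)
    finally show ?thesis by (simp add: y_def algebra_simps)
  qed
  show "uniform_limit S (\<lambda>n t. y n t / n) (\<lambda>_. 2 * pi * \<i>) sequentially"
  proof (rule uniform_lim_bound)
    show "(\<lambda>n. (\<bar>\<sigma>\<bar> * ln (real n) + \<bar>R\<bar>) / real n) \<longlonglongrightarrow> 0"
      by real_asymp
    show "\<forall>\<^sub>F n in sequentially. \<forall>t\<in>S. cmod (y n t / n - 2 * pi * \<i>) \<le> (\<bar>\<sigma>\<bar> * ln (real n) + \<bar>R\<bar>) / real n"
      using eventually_ge_at_top[of 1]
    proof eventually_elim
      case (elim n)
      have "y n t / n - 2 * pi * \<i> = (y n t - 2 * pi * \<i> * n) / n" for t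
        using elim by (simp add: field_simps)
      then show ?case
        using yb elim by (simp add: norm_divide divide_right_mono)
    qed
  qed
  define Y where "Y = (\<lambda>n::nat. 2 * pi * n + \<bar>\<sigma>\<bar> * ln n + \<bar>R\<bar>)"
  show "uniform_limit S (\<lambda>n t. x n t / of_nat n ^ r) (\<lambda>_. 2 * pi * \<i>) sequentially"
  proof (rule uniform_lim_bound)
    show "(\<lambda>n. (Y n + pi) / real n ^ 2) \<longlonglongrightarrow> 0"
      unfolding Y_def by real_asymp
    have "eventually (\<lambda>n::nat. \<bar>\<sigma>\<bar> * ln n + \<bar>R\<bar> \<le> n) sequentially"
      by real_asymp
    with eventually_ge_at_top[of 1]
    show "\<forall>\<^sub>F n in sequentially. \<forall>t\<in>S. cmod (x n t / of_nat n ^ r - 2 * pi * \<i>) \<le> (Y n + pi) / real n ^ 2"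
    proof eventually_elim
      case (elim n)
      show ?case
      proof
        fix t assume t: "t \<in> S"
        have c: "cmod (2 * pi * \<i> * n) = 2 * pi * n" by (simp add: norm_mult)
        have lo: "2 * pi * n - n \<le> cmod (y n t)"
          using norm_triangle_ineq2[of "2 * pi * \<i> * n" "y n t"] yb[OF elim(1) t] elim(2)
          unfolding c norm_minus_commute[of _ "y n t"] by linarith
        \<comment> \<open>Modulus at least 1 makes the logarithm of the modulus nonnegative, so it
          is bounded by the modulus itself.\<close>
        have "1 * 1 \<le> (2 * pi - 1) * n"
          using pi_gt3 elim(1) by (intro mult_mono) auto
        then have y1: "1 \<le> cmod (y n t)"
          using lo by (simp add: algebra_simps)
        have hi: "cmod (y n t) \<le> Y n"
          using norm_triangle_ineq2[of "y n t" "2 * pi * \<i> * n"] yb[OF elim(1) t]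
          unfolding c Y_def by linarith
        have "cmod (Ln (y n t)) \<le> \<bar>ln (cmod (y n t))\<bar> + pi"
          using y1 by (intro cmod_Ln_le) auto
        also have "\<bar>ln (cmod (y n t))\<bar> \<le> cmod (y n t)"
          using y1 ln_bound[of "cmod (y n t)"] ln_ge_zero[OF y1] by linarith
        finally have L: "cmod (Ln (y n t)) \<le> Y n + pi"
          using hi by simp
        have "x n t / of_nat n ^ r - 2 * pi * \<i> = Ln (y n t) / of_nat n ^ r"
          using elim by (simp add: x_def field_simps)
        then have "cmod (x n t / of_nat n ^ r - 2 * pi * \<i>) = cmod (Ln (y n t)) / real n ^ r"
          by (simp add: norm_divide norm_power)
        also have "\<dots> \<le> (Y n + pi) / real n ^ 2"
          using L elim(1) r by (intro frac_le power_increasing) (auto intro: order_trans[OF norm_ge_zero])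
        finally show "cmod (x n t / of_nat n ^ r - 2 * pi * \<i>) \<le> (Y n + pi) / real n ^ 2" .
      qed
    qed
  qed
qed


section \<open>Zeros from Hurwitz's theorem\<close>

lemma exp_2pi_nat: "exp (of_nat k * (of_real (2 * pi) * \<i>)) = 1"
  using exp_integer_2pi[of "of_nat k"] by (simp add: mult_ac)

text \<open>On the curve the term of \<open>s\<close> has order \<open>n\<close> to the power
  \<open>W s + \<sigma> * L s\<close>, so after division by \<open>n\<close> to the power
  \<open>A\<close> only the terms on the Newton edge survive in the limit. The size condition holds
  because \<open>exp x = y\<close> has order \<open>n\<close> while \<open>x\<close> has order
  \<open>n ^ r\<close>.\<close>

lemma zeros_far_out:
  fixes \<beta> :: "'a \<Rightarrow> complex" and K M L :: "'a \<Rightarrow> nat" and \<delta> :: real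
  assumes fin: "finite S" and inj: "inj_on (\<lambda>s. (K s, M s, L s)) S"
    and nz: "\<And>s. s \<in> S \<Longrightarrow> \<beta> s \<noteq> 0" and two: "s1 \<in> S" "s2 \<in> S" "L s1 \<noteq> L s2" and \<delta>: "0 < \<delta>"
  obtains a where "(\<Sum>s\<in>S. \<beta> s * a ^ K s * exp a ^ M s * exp (exp a) ^ L s) = 0"
    "cmod (exp a) < \<delta> * cmod a"
proof -
  \<comment> \<open>Since \<open>r\<close> exceeds every \<open>M s\<close>, the weight
    \<open>r * K s + M s\<close> has \<open>K s\<close> and \<open>M s\<close> as quotient and
    remainder modulo \<open>r\<close>. Hence terms on the edge with equal \<open>L\<close>
    coincide.\<close>
  define r where "r = Suc (Suc (\<Sum>s\<in>S. M s))"
  have r: "2 \<le> r" "M s < r" if "s \<in> S" for s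
    using member_le_sum[of s S M] that fin by (auto simp: r_def)
  have r2: "2 \<le> r" by (simp add: r_def)
  define W where "W = (\<lambda>s. real (r * K s + M s))"
  obtain \<sigma> A s s' where edge: "\<And>s. s \<in> S \<Longrightarrow> W s + \<sigma> * real (L s) \<le> A"
    "s \<in> S" "s' \<in> S" "L s \<noteq> L s'" "W s + \<sigma> * real (L s) = A" "W s' + \<sigma> * real (L s') = A"
    using newton_edge[OF fin two, of W] by metis
  define S' where "S' = {s \<in> S. W s + \<sigma> * real (L s) = A}"
  have injL: "inj_on L S'"
  proof (rule inj_onI)
    fix u v assume uv: "u \<in> S'" "v \<in> S'" "L u = L v"
    then have "W u = W v" by (simp add: S'_def)
    then have e: "r * K u + M u = r * K v + M v"
      unfolding W_def of_nat_eq_iff .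
    have "(r * K u + M u) div r = K u" "(r * K v + M v) div r = K v"
      using r(2)[of u] r(2)[of v] r2 uv by (simp_all add: S'_def)
    then have "K u = K v" "M u = M v"
      using e by auto
    then show "u = v"
      using inj uv by (auto simp: S'_def inj_on_def)
  qed
  \<comment> \<open>The normalised \<open>x\<close> and \<open>y\<close> both tend to
    \<open>2 * pi * \<i>\<close>, which supplies the powers in the limiting coefficients.\<close>
  define \<gamma> where "\<gamma> = (\<lambda>s. \<beta> s * (2 * pi * \<i>) ^ (K s + M s))"
  define G where "G = (\<lambda>t. \<Sum>s\<in>S'. \<gamma> s * exp (of_nat (L s) * t))"
  obtain t0 where t0: "G t0 = 0" "\<not> G constant_on ball t0 1"
  proof (rule exp_sum_zero[of S' L s s' \<gamma>])
    show "\<gamma> u \<noteq> 0" if "u \<in> S'" for u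
      using that nz by (simp add: S'_def \<gamma>_def)
  qed (use fin injL edge that in \<open>auto simp: S'_def G_def\<close>)
  define B where "B = ball t0 1"
  have B: "cmod t \<le> cmod t0 + 1" if "t \<in> B" for t
    using that norm_triangle_ineq2[of t t0] by (auto simp: B_def dist_norm norm_minus_commute)
  define y where "y = (\<lambda>(n::nat) t. 2 * pi * \<i> * n + \<sigma> * of_real (ln n) + t)"
  define x where "x = (\<lambda>n t. Ln (y n t) + 2 * pi * \<i> * of_nat (n ^ r))"
  have uy: "uniform_limit B (\<lambda>n t. y n t / n) (\<lambda>_. 2 * pi * \<i>) sequentially"
    and ux: "uniform_limit B (\<lambda>n t. x n t / of_nat n ^ r) (\<lambda>_. 2 * pi * \<i>) sequentially"
    using exponential_curve_asymptotics[OF r2, of B, OF B, of \<sigma>] by (simp_all add: y_def x_def)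
  \<comment> \<open>\<open>F n t\<close> is the original sum on the curve divided by
    \<open>exp (A * ln n)\<close>; this is verified at the end, for the \<open>n\<close> and
    \<open>t\<close> found there.\<close>
  define F where "F = (\<lambda>n t. \<Sum>s\<in>S. \<beta> s * ((x n t / of_nat n ^ r) ^ K s * (y n t / n) ^ M s) *
    (exp (of_nat (L s) * t) * of_real (exp ((W s + \<sigma> * real (L s) - A) * ln n))))"
  have FG: "uniform_limit B F G sequentially"
  proof -
    have term_lim: "uniform_limit B (\<lambda>n t. \<beta> s * ((x n t / of_nat n ^ r) ^ K s * (y n t / n) ^ M s) *
        (exp (of_nat (L s) * t) * of_real (exp ((W s + \<sigma> * real (L s) - A) * ln n))))
      (\<lambda>t. \<beta> s * ((2 * pi * \<i>) ^ K s * (2 * pi * \<i>) ^ M s) * (exp (of_nat (L s) * t) * (if s \<in> S' then 1 else 0))) sequentially"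
      if s: "s \<in> S" for s
    proof -
      have "(\<lambda>n. complex_of_real (exp ((W s + \<sigma> * real (L s) - A) * ln (real n)))) \<longlonglongrightarrow> (if s \<in> S' then 1 else 0)"
      proof (cases "s \<in> S'")
        case True
        then show ?thesis by (simp add: S'_def)
      next
        case False
        then have neg: "W s + \<sigma> * real (L s) - A < 0"
          using edge(1)[OF s] s by (simp add: S'_def)
        define c where "c = - (W s + \<sigma> * real (L s) - A)"
        have "c > 0" using neg by (simp add: c_def)
        then have "(\<lambda>n. exp (- c * ln (real n))) \<longlonglongrightarrow> 0"
          by real_asymp
        then have "(\<lambda>n. complex_of_real (exp (- c * ln (real n)))) \<longlonglongrightarrow> of_real 0"
          by (rule tendsto_of_real)
        then show ?thesis using False by (simp add: c_def)
      qed
      then have uc: "uniform_limit B (\<lambda>n t. complex_of_real (exp ((W s + \<sigma> * real (L s) - A) * ln (real n))))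
          (\<lambda>_. if s \<in> S' then 1 else 0) sequentially"
        by (intro uniform_lim_bound[where h = "\<lambda>n. cmod (complex_of_real (exp ((W s + \<sigma> * real (L s) - A) * ln (real n)))
           - (if s \<in> S' then 1 else 0))"] always_eventually) (auto simp: tendsto_norm_zero LIM_zero)
      have bc: "bounded ((\<lambda>_. c) ` B)" for c :: complex
        by (simp add: image_constant_conv)
      \<comment> \<open>Multiplying uniform limits needs bounded limit functions; the open ball
        inherits boundedness from the compact closed one.\<close>
      have be: "bounded ((\<lambda>t. exp (of_nat (L s) * t)) ` B)"
      proof (rule bounded_subset)
        show "bounded ((\<lambda>t. exp (of_nat (L s) * t)) ` cball t0 1)"
          by (intro compact_imp_bounded compact_continuous_image continuous_intros) auto
      qed (auto simp: B_def)
      have "bounded ((\<lambda>t. exp (of_nat (L s) * t) * (if s \<in> S' then 1 else 0)) ` B)"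
        using be by (cases "s \<in> S'") (auto intro: bc)
      then show ?thesis
        by (intro uniform_lim_mult uniform_lim_power uniform_limit_const uc be bc ux uy)
    qed
    have G_eq: "G = (\<lambda>t. \<Sum>s\<in>S. \<beta> s * ((2 * pi * \<i>) ^ K s * (2 * pi * \<i>) ^ M s) * (exp (of_nat (L s) * t) * (if s \<in> S' then 1 else 0)))"
      unfolding G_def S'_def using fin
      by (auto simp: sum.inter_filter \<gamma>_def power_add if_distrib intro!: ext sum.cong)
    then show ?thesis
      unfolding F_def G_eq by (intro uniform_lim_sum term_lim)
  qed
  \<comment> \<open>The threshold \<open>8 / (5 * \<delta>)\<close> fits the final estimates
    \<open>|y| < 8 n\<close> and \<open>|x| > 5 n ^ r\<close>.\<close>
  have "eventually (\<lambda>n. n \<ge> 1 \<and> real n > 8 / (5 * \<delta>) \<and> (\<forall>t\<in>B. dist (y n t / n) (2 * pi * \<i>) < 1) \<and>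
    (\<forall>t\<in>B. dist (x n t / of_nat n ^ r) (2 * pi * \<i>) < 1)) sequentially"
    by (intro eventually_conj eventually_ge_at_top uniform_limitD[OF uy] uniform_limitD[OF ux] zero_less_one
        filterlim_at_top_dense[THEN iffD1, rule_format] filterlim_real_sequentially)
  then obtain N where N: "\<And>n. n \<ge> N \<Longrightarrow> n \<ge> 1" "\<And>n. n \<ge> N \<Longrightarrow> real n > 8 / (5 * \<delta>)"
    "\<And>n t. n \<ge> N \<Longrightarrow> t \<in> B \<Longrightarrow> dist (y n t / n) (2 * pi * \<i>) < 1"
    "\<And>n t. n \<ge> N \<Longrightarrow> t \<in> B \<Longrightarrow> dist (x n t / of_nat n ^ r) (2 * pi * \<i>) < 1"
    unfolding eventually_sequentially by blast
  \<comment> \<open>Staying off the branch cut makes \<open>Ln (y n t)\<close> holomorphic in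
    \<open>t\<close>; the imaginary part of \<open>y / n\<close> is within 1 of
    \<open>2 * pi\<close>.\<close>
  have y_slit: "y n t \<notin> \<real>\<^sub>\<le>\<^sub>0" if "n \<ge> N" "t \<in> B" for n t
  proof -
    have "\<bar>Im (y n t / n - 2 * pi * \<i>)\<bar> < 1"
      using N(3)[OF that] abs_Im_le_cmod[of "y n t / n - 2 * pi * \<i>"] by (simp add: dist_norm)
    then have "Im (y n t / n) > 0"
      using pi_gt3 by (simp add: abs_less_iff)
    then show ?thesis
      using N(1)[OF that(1)] by (auto simp: complex_nonpos_Reals_iff)
  qed
  \<comment> \<open>If no \<open>F n\<close> beyond \<open>N\<close> had a zero in the ball,
    Hurwitz's theorem would make the nonconstant limit \<open>G\<close> free of zeros there, against
    \<open>G t0 = 0\<close>. The shift by \<open>N\<close> makes every member of the sequence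
    holomorphic.\<close>
  have "\<exists>n\<ge>N. \<exists>t\<in>B. F n t = 0"
  proof (rule ccontr)
    assume "\<not> ?thesis"
    then have nzF: "F (n + N) t \<noteq> 0" if "t \<in> B" for n t
      using that by auto
    have "G t0 \<noteq> 0"
    proof (rule Hurwitz_no_zeros[of B "\<lambda>n. F (n + N)" G])
      show "(F (n + N)) holomorphic_on B" for n
      proof -
        have "n + N \<ge> 1" using N(1)[of "n+N"] by simp
        then show ?thesis
          unfolding F_def x_def using y_slit[of "n + N"]
          by (intro holomorphic_intros) (auto simp: y_def intro!: holomorphic_intros)
      qed
      show "G holomorphic_on B"
        unfolding G_def by (intro holomorphic_intros)
      show "uniform_limit C (\<lambda>n. F (n + N)) G sequentially" if "C \<subseteq> B" for C
      proof -
        have "uniform_limit C F G sequentially"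
          using FG that by (rule uniform_limit_on_subset)
        then show ?thesis
          using filterlim_compose[OF _ filterlim_add_const_nat_at_top[of N]] by auto
      qed
    qed (use nzF t0 in \<open>auto simp: B_def\<close>)
    then show False using t0 by simp
  qed
  then obtain n t where nt: "n \<ge> N" "t \<in> B" "F n t = 0" by blast
  have n1: "n \<ge> 1" using N(1) nt by blast
  have y0: "y n t \<noteq> 0" using y_slit[OF nt(1,2)] by auto
  have exp_x: "exp (x n t) = y n t"
  proof -
    have "exp (2 * pi * \<i> * of_nat (n ^ r)) = exp (of_nat (n ^ r) * (2 * pi * \<i>))"
      by (simp only: mult.commute)
    also have "\<dots> = 1" by (rule exp_2pi_nat)
    finally show ?thesis using y0 by (simp add: x_def exp_add)
  qed
  have exp_y: "exp (y n t) ^ l = of_real (exp (\<sigma> * real l * ln n)) * exp (of_nat l * t)" for l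
  proof -
    have "of_nat l * y n t = of_nat (l * n) * (2 * pi * \<i>) + of_real (\<sigma> * real l * ln n) + of_nat l * t"
      by (simp add: y_def algebra_simps)
    moreover have "exp (of_nat (l * n) * (2 * pi * \<i>)) = 1"
      by (rule exp_2pi_nat)
    ultimately show ?thesis
      by (simp only: exp_add exp_of_real mult_1_left exp_of_nat_mult[symmetric])
  qed
  show ?thesis
  proof (rule that[of "x n t"])
    have "\<beta> s * x n t ^ K s * y n t ^ M s * exp (y n t) ^ L s = of_real (exp (A * ln n)) *
        (\<beta> s * ((x n t / of_nat n ^ r) ^ K s * (y n t / n) ^ M s) *
        (exp (of_nat (L s) * t) * of_real (exp ((W s + \<sigma> * real (L s) - A) * ln n))))" for s
    proof -
      have "exp (A * ln n) * exp ((W s + \<sigma> * real (L s) - A) * ln n) = exp (W s * ln n) * exp (\<sigma> * real (L s) * ln n)"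
        by (simp add: algebra_simps flip: exp_add)
      also have "exp (W s * ln n) = (real n ^ r) ^ K s * real n ^ M s"
        using n1 unfolding W_def exp_of_nat_mult by (simp add: power_add power_mult)
      finally have e: "exp (A * ln n) * exp ((W s + \<sigma> * real (L s) - A) * ln n) =
          (real n ^ r) ^ K s * real n ^ M s * exp (\<sigma> * real (L s) * ln n)" .
      have e1: "complex_of_real (exp (A * ln n)) * of_real (exp ((W s + \<sigma> * real (L s) - A) * ln n))
         = (of_nat n ^ r) ^ K s * of_nat n ^ M s * of_real (exp (\<sigma> * real (L s) * ln n))"
        using arg_cong[OF e, of complex_of_real]
        by (simp only: of_real_mult of_real_power of_real_of_nat_eq)
      have e2: "(x n t / of_nat n ^ r) ^ K s * (of_nat n ^ r) ^ K s = x n t ^ K s"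
        and e3: "(y n t / n) ^ M s * of_nat n ^ M s = y n t ^ M s"
        using n1 by (simp_all flip: power_mult_distrib)
      \<comment> \<open>The regrouping of factors is isolated as a commutative identity in fresh
        variables, so that rewriting does not touch the powers.\<close>
      have gen: "b * X' * Y' * (g * E) = e * (b * (X * Y) * (E * d))"
        if "e * d = p * q * g" "X * p = X'" "Y * q = Y'" for b e d g p q E X Y X' Y' :: complex
        unfolding that(2,3)[symmetric] using arg_cong[OF that(1), of "\<lambda>u. b * (X * Y) * E * u"]
        by (simp only: mult_ac)
      show ?thesis
        unfolding exp_y by (rule gen[OF e1 e2 e3])
    qed
    then have "(\<Sum>s\<in>S. \<beta> s * x n t ^ K s * y n t ^ M s * exp (y n t) ^ L s) = of_real (exp (A * ln n)) * F n t"
      unfolding F_def sum_distrib_left by (intro sum.cong refl)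
    then show "(\<Sum>s\<in>S. \<beta> s * x n t ^ K s * exp (x n t) ^ M s * exp (exp (x n t)) ^ L s) = 0"
      using nt(3) by (simp add: exp_x)
    have c: "cmod (2 * complex_of_real pi * \<i>) = 2 * pi" by (simp add: norm_mult)
    have "cmod (y n t / n) \<le> 2 * pi + 1"
      using N(3)[OF nt(1,2)] norm_triangle_ineq2[of "y n t / n" "2 * pi * \<i>"] by (simp add: dist_norm c)
    then have "cmod (y n t / n) < 8"
      using pi_less_4 pi_approx by simp
    then have y8: "cmod (y n t) < 8 * n"
      using n1 by (simp add: norm_divide field_simps)
    have "cmod (x n t / of_nat n ^ r) \<ge> 2 * pi - 1"
      using N(4)[OF nt(1,2)] norm_triangle_ineq2[of "2 * pi * \<i>" "x n t / of_nat n ^ r"]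
      by (simp add: dist_norm c norm_minus_commute)
    then have "cmod (x n t / of_nat n ^ r) > 5"
      using pi_gt3 by simp
    then have x5: "cmod (x n t) > 5 * real n ^ r"
      using n1 by (simp add: norm_divide norm_power field_simps)
    have "8 * real n \<le> \<delta> * (5 * real n ^ 2)"
      using N(2)[OF nt(1)] n1 \<delta> by (simp add: field_simps power2_eq_square)
    also have "\<dots> \<le> \<delta> * (5 * real n ^ r)"
      using \<delta> n1 r2 by (intro mult_left_mono power_increasing) auto
    also have "\<dots> \<le> \<delta> * cmod (x n t)"
      using \<delta> x5 by (intro mult_left_mono) auto
    finally show "cmod (exp (x n t)) < \<delta> * cmod (x n t)"
      using y8 by (simp add: exp_x)
  qed
qed

section \<open>Transcendence degree and growth of monomials\<close>

text \<open>Finitely many algebraic numbers generate a finite-dimensional rational algebra.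
  \<open>V\<close> is built by multiplying the previous spanning set with the powers of each new
  number; it lets algebraic coefficients be handled by linear algebra over the rationals.\<close>

lemma finite_span_closed_under_algebraic:
  assumes "finite A" "\<And>\<alpha>. \<alpha> \<in> A \<Longrightarrow> algebraic \<alpha>"
  obtains V where "finite V" "1 \<in> V" "\<And>\<alpha> v. \<alpha> \<in> A \<Longrightarrow> v \<in> V \<Longrightarrow> \<alpha> * v \<in> rat_vs.span V"
proof -
  have "\<exists>V. finite V \<and> 1 \<in> V \<and> (\<forall>\<alpha>\<in>A. \<forall>v\<in>V. \<alpha> * v \<in> rat_vs.span V)"
    using assms
  proof (induction A rule: finite_induct)
    case empty
    show ?case by (intro exI[of _ "{1}"]) auto
  next
    case (insert \<alpha> A)
    then obtain V where V: "finite V" "1 \<in> V" "\<And>\<beta> v. \<beta> \<in> A \<Longrightarrow> v \<in> V \<Longrightarrow> \<beta> * v \<in> rat_vs.span V"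
      by auto
    obtain n where n: "\<And>k. \<alpha> ^ k \<in> rat_vs.span ((\<lambda>i. \<alpha> ^ i) ` {..<n})"
      using algebraic_powers_in_span insert.prems by blast
    have "n \<noteq> 0" using n[of 0] by (cases "n = 0") auto
    define V' where "V' = (\<lambda>(a, b). a * b) ` (V \<times> (\<lambda>i. \<alpha> ^ i) ` {..<n})"
    have sp: "x * \<alpha> ^ k \<in> rat_vs.span V'" if "x \<in> rat_vs.span V" for x k
      unfolding V'_def by (rule span_mult_mem[OF that n])
    have "1 * \<alpha> ^ 0 \<in> V'"
      using V(2) \<open>n \<noteq> 0\<close> unfolding V'_def by force
    moreover have "\<beta> * v \<in> rat_vs.span V'" if "\<beta> \<in> insert \<alpha> A" "v \<in> V'" for \<beta> v
    proof -
      obtain v0 i where v: "v0 \<in> V" "v = v0 * \<alpha> ^ i"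
        using \<open>v \<in> V'\<close> by (auto simp: V'_def)
      show ?thesis
      proof (cases "\<beta> = \<alpha>")
        case True
        then show ?thesis
          using sp[OF rat_vs.span_base[OF v(1)], of "Suc i"] v(2) by (metis mult.left_commute power_Suc)
      next
        case False
        then show ?thesis
          using sp[OF V(3)[of \<beta> v0], of i] v that by (simp add: mult.assoc)
      qed
    qed
    ultimately show ?case
      using V(1) by (intro exI[of _ V']) (auto simp: V'_def)
  qed
  then show ?thesis using that by blast
qed

text \<open>Repeatedly replacing the leading monomial \<open>e \<mu>\<close> of a relation by the remaining terms.\<close>

lemma monomial_reduction:
  fixes e :: "'m::comm_monoid_add \<Rightarrow> complex" and \<omega> :: "'m \<Rightarrow> nat"
  assumes e: "\<And>m n. e (m + n) = e m * e n" and \<omega>: "\<And>m n. \<omega> (m + n) = \<omega> m + \<omega> n"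
    and rel: "e \<mu> = (\<Sum>\<nu>\<in>N. \<kappa> \<nu> * e \<nu>)" and less: "\<And>\<nu>. \<nu> \<in> N \<Longrightarrow> \<omega> \<nu> < \<omega> \<mu>"
    and V: "\<And>\<nu> v. \<nu> \<in> N \<Longrightarrow> v \<in> V \<Longrightarrow> \<kappa> \<nu> * v \<in> rat_vs.span V"
    and v: "v \<in> rat_vs.span V" and b: "\<omega> m \<le> b"
  shows "v * e m \<in> rat_vs.span ((\<lambda>(v, m). v * e m) ` (V \<times> {m. \<omega> m \<le> b \<and> m \<notin> range ((+) \<mu>)}))"
    (is "_ \<in> rat_vs.span ?W")
  using v b
proof (induction "\<omega> m" arbitrary: m v rule: less_induct)
  case less
  show ?case
    using less(2)
  proof (induction rule: rat_vs.span_induct_alt)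
    case base
    show ?case by (simp add: rat_vs.span_zero)
  next
    case (step q x y)
    have "x * e m \<in> rat_vs.span ?W"
    proof (cases "m \<in> range ((+) \<mu>)")
      case False
      then show ?thesis
        using step(1) less(3) by (intro rat_vs.span_base) auto
    next
      case True
      then obtain n where n: "m = \<mu> + n" by auto
      have "x * e m = (\<Sum>\<nu>\<in>N. (\<kappa> \<nu> * x) * e (\<nu> + n))"
        by (simp add: n e rel sum_distrib_left sum_distrib_right mult_ac)
      also have "\<dots> \<in> rat_vs.span ?W"
      proof (rule rat_vs.span_sum)
        fix \<nu> assume "\<nu> \<in> N"
        then have "\<omega> (\<nu> + n) < \<omega> m"
          using assms(4) by (simp add: n \<omega>)
        then show "\<kappa> \<nu> * x * e (\<nu> + n) \<in> rat_vs.span ?W"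
          using less(1)[of "\<nu> + n" "\<kappa> \<nu> * x"] less(3) V[OF \<open>\<nu> \<in> N\<close> step(1)] by simp
      qed
      finally show ?thesis .
    qed
    then have "of_rat q * (x * e m) + y * e m \<in> rat_vs.span ?W"
      using step by (intro rat_vs.span_add rat_vs.span_scale)
    then show ?case by (simp add: algebra_simps)
  qed
qed

lemma algebraic_divide_complex:
  "algebraic (x :: complex) \<Longrightarrow> algebraic y \<Longrightarrow> algebraic (x / y)"
  by (simp add: divide_inverse algebraic_mult algebraic_inverse)

text \<open>The relation of degree \<open>d\<close> reduces every power of \<open>x\<close> to
  powers below \<open>d\<close> with coefficients in the span of a fixed finite \<open>V\<close>, so
  all powers lie in one finite-dimensional rational space.\<close>

lemma algebraic_if_root:
  fixes p :: "complex poly"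
  assumes "p \<noteq> 0" "poly p x = 0" "\<And>i. algebraic (coeff p i)"
  shows "algebraic x"
proof -
  define d where "d = degree p"
  define \<kappa> where "\<kappa> = (\<lambda>i. - coeff p i / lead_coeff p)"
  have "(\<Sum>i\<le>d. coeff p i * x ^ i) = 0"
    using assms(2) by (simp add: poly_altdef d_def)
  then have "lead_coeff p * x ^ d = - (\<Sum>i<d. coeff p i * x ^ i)"
    by (simp add: d_def lessThan_Suc_atMost[symmetric] eq_neg_iff_add_eq_0 add.commute)
  then have rel: "x ^ d = (\<Sum>i<d. \<kappa> i * x ^ i)"
    using assms(1) by (simp add: \<kappa>_def sum_negf field_simps flip: sum_divide_distrib)
  have alg: "algebraic (\<kappa> i)" for i
    unfolding \<kappa>_def using assms(3) by (intro algebraic_divide_complex) auto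
  obtain V where V: "finite V" "1 \<in> V" "\<And>\<alpha> v. \<alpha> \<in> \<kappa> ` {..<d} \<Longrightarrow> v \<in> V \<Longrightarrow> \<alpha> * v \<in> rat_vs.span V"
    using finite_span_closed_under_algebraic[of "\<kappa> ` {..<d}"] alg by auto
  define W where "W = (\<lambda>(v, m). v * x ^ m) ` (V \<times> {..<d})"
  show ?thesis
  proof (rule algebraic_if_powers_in_span)
    show "finite W" using V by (simp add: W_def)
    fix k
    have "1 * x ^ k \<in> rat_vs.span ((\<lambda>(v, m). v * x ^ m) ` (V \<times> {m. id m \<le> k \<and> m \<notin> range ((+) d)}))"
      using rel V by (intro monomial_reduction[where \<kappa> = \<kappa> and N = "{..<d}"]) (auto simp: power_add rat_vs.span_base)
    moreover have "{m. id m \<le> k \<and> m \<notin> range ((+) d)} \<subseteq> {..<d}"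
      by (metis (mono_tags, lifting) CollectD le_Suc_ex lessThan_iff linorder_not_less rangeI subsetI)
    ultimately show "x ^ k \<in> rat_vs.span W"
      unfolding W_def by (metis (no_types, lifting) Sigma_mono image_mono mult_1 order_refl rat_vs.span_mono subsetD)
  qed
qed

lemma obtain_dominating_term:
  fixes \<omega> :: "'a \<Rightarrow> nat"
  assumes "finite S" "S \<noteq> {}" "inj_on \<omega> S"
  obtains \<mu> where "\<mu> \<in> S" "\<And>\<nu>. \<nu> \<in> S - {\<mu>} \<Longrightarrow> \<omega> \<nu> < \<omega> \<mu>"
proof -
  have "Max (\<omega> ` S) \<in> \<omega> ` S" using assms by (intro Max_in) auto
  then obtain \<mu> where \<mu>: "\<mu> \<in> S" "\<omega> \<mu> = Max (\<omega> ` S)" by auto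
  have "\<omega> \<nu> < \<omega> \<mu>" if "\<nu> \<in> S - {\<mu>}" for \<nu>
    using that \<mu> assms by (metis DiffE Max_ge finite_imageI image_eqI inj_onD insertI1 le_neq_implies_less)
  then show ?thesis using that \<mu> by blast
qed

definition mono3 :: "complex \<Rightarrow> complex \<Rightarrow> complex \<Rightarrow> nat \<times> nat \<times> nat \<Rightarrow> complex" where
  "mono3 a b c = (\<lambda>(i, j, k). a ^ i * b ^ j * c ^ k)"

lemma mono3_add: "mono3 a b c (m + n) = mono3 a b c m * mono3 a b c n"
  by (cases m; cases n) (simp add: mono3_def power_add mult_ac)

text \<open>The relation eliminates every multiple of its leading monomial \<open>\<mu>\<close>. A
  monomial that is not such a multiple has one of its three exponents below that of
  \<open>\<mu>\<close>, so among exponents bounded linearly in \<open>M\<close> only quadratically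
  many remain.\<close>

lemma quadratic_growth:
  fixes \<kappa> :: "nat \<times> nat \<times> nat \<Rightarrow> complex"
  assumes "finite S" "S \<noteq> {}" and \<kappa>: "\<And>s. s \<in> S \<Longrightarrow> \<kappa> s \<noteq> 0" "\<And>s. s \<in> S \<Longrightarrow> algebraic (\<kappa> s)"
    and rel: "(\<Sum>s\<in>S. \<kappa> s * mono3 a b c s) = 0"
  obtains C where "\<And>M. \<exists>W. finite W \<and> card W \<le> C * (M + 1) ^ 2 \<and>
    mono3 a b c ` ({..M} \<times> {..M} \<times> {..M}) \<subseteq> rat_vs.span W"
proof -
  \<comment> \<open>\<open>B\<close> exceeds all exponents in \<open>S\<close>, so the additive
    weight \<open>\<omega>\<close>, which reads a triple as digits in base \<open>B\<close>,
    separates the monomials of the relation and singles out a leading one.\<close>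
  define B where "B = Suc (\<Sum>(i, j, k)\<in>S. i + j + k)"
  have B: "i < B \<and> j < B \<and> k < B" if "(i, j, k) \<in> S" for i j k
    using member_le_sum[of "(i, j, k)" S "\<lambda>(i, j, k). i + j + k"] that assms(1) by (auto simp: B_def)
  define \<omega> where "\<omega> = (\<lambda>(i, j, k). i + B * (j + B * k))"
  have \<omega>_add: "\<omega> (m + n) = \<omega> m + \<omega> n" for m n
    by (cases m; cases n) (simp add: \<omega>_def algebra_simps)
  have "inj_on \<omega> S"
  proof (rule inj_onI)
    fix s t assume st: "s \<in> S" "t \<in> S" "\<omega> s = \<omega> t"
    obtain i j k i' j' k' where s: "s = (i, j, k)" and t: "t = (i', j', k')"
      by (metis prod_cases3)
    have b: "i < B" "j < B" "i' < B" "j' < B" using B st s t by auto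
    have eq: "i + B * (j + B * k) = i' + B * (j' + B * k')"
      using st by (simp add: \<omega>_def s t)
    have 1: "i = i'" using arg_cong[OF eq, of "\<lambda>n. n mod B"] b by simp
    have 2: "j + B * k = j' + B * k'" using arg_cong[OF eq, of "\<lambda>n. n div B"] b by simp
    have "j = j'" using arg_cong[OF 2, of "\<lambda>n. n mod B"] b by simp
    moreover have "k = k'" using arg_cong[OF 2, of "\<lambda>n. n div B"] b by simp
    ultimately show "s = t" using 1 s t by simp
  qed
  then obtain \<mu> where \<mu>: "\<mu> \<in> S" "\<And>\<nu>. \<nu> \<in> S - {\<mu>} \<Longrightarrow> \<omega> \<nu> < \<omega> \<mu>"
    using obtain_dominating_term assms(1,2) by metis
  define \<eta> where "\<eta> = (\<lambda>\<nu>. - \<kappa> \<nu> / \<kappa> \<mu>)"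
  have alg: "algebraic (\<eta> \<nu>)" if "\<nu> \<in> S - {\<mu>}" for \<nu>
    unfolding \<eta>_def using \<kappa> \<mu> that by (intro algebraic_divide_complex) auto
  have "\<kappa> \<mu> * mono3 a b c \<mu> + (\<Sum>\<nu>\<in>S-{\<mu>}. \<kappa> \<nu> * mono3 a b c \<nu>) = 0"
    using rel assms(1) \<mu>(1) by (simp add: sum.remove)
  then have rel': "mono3 a b c \<mu> = (\<Sum>\<nu>\<in>S-{\<mu>}. \<eta> \<nu> * mono3 a b c \<nu>)"
    using \<kappa>(1)[OF \<mu>(1)] by (simp add: \<eta>_def sum_negf field_simps add_eq_0_iff flip: sum_divide_distrib)
  obtain V where V: "finite V" "1 \<in> V" "\<And>\<alpha> v. \<alpha> \<in> \<eta> ` (S - {\<mu>}) \<Longrightarrow> v \<in> V \<Longrightarrow> \<alpha> * v \<in> rat_vs.span V"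
    using finite_span_closed_under_algebraic[of "\<eta> ` (S - {\<mu>})"] alg assms(1)
    by (metis (no_types, lifting) finite_Diff finite_imageI imageE)
  obtain \<mu>1 \<mu>2 \<mu>3 where \<mu>3: "\<mu> = (\<mu>1, \<mu>2, \<mu>3)" by (metis prod_cases3)
  \<comment> \<open>With \<open>q = 1 + B + B^2\<close>, exponents at most \<open>M\<close> have
    weight at most \<open>q * M\<close>.\<close>
  define q where "q = 1 + B * (1 + B)"
  have "1 \<le> q" by (simp add: q_def)
  define C where "C = card V * (\<mu>1 + \<mu>2 + \<mu>3) * q ^ 2"
  show ?thesis
  proof (rule that[of C])
    fix M
    define b' where "b' = q * M"
    define E where "E = {..<\<mu>1} \<times> {..b'} \<times> {..b'} \<union> {..b'} \<times> {..<\<mu>2} \<times> {..b'} \<union> {..b'} \<times> {..b'} \<times> {..<\<mu>3}"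
    define W where "W = (\<lambda>(v, m). v * mono3 a b c m) ` (V \<times> E)"
    have "finite E" by (simp add: E_def)
    then have "finite W" using V by (simp add: W_def)
    have "card E \<le> \<mu>1 * ((b' + 1) * (b' + 1)) + (b' + 1) * (\<mu>2 * (b' + 1)) + (b' + 1) * ((b' + 1) * \<mu>3)"
      unfolding E_def by (intro order_trans[OF card_Un_le] add_mono) (simp_all add: card_cartesian_product)
    also have "\<dots> = (\<mu>1 + \<mu>2 + \<mu>3) * (b' + 1) ^ 2"
      by (simp add: power2_eq_square algebra_simps)
    also have "\<dots> \<le> (\<mu>1 + \<mu>2 + \<mu>3) * (q * (M + 1)) ^ 2"
      using \<open>1 \<le> q\<close> by (intro mult_left_mono power_mono) (auto simp: b'_def)
    finally have cE: "card E \<le> (\<mu>1 + \<mu>2 + \<mu>3) * (q * (M + 1)) ^ 2" .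
    have "card W \<le> card (V \<times> E)"
      unfolding W_def using V \<open>finite E\<close> by (intro card_image_le) auto
    also have "\<dots> = card V * card E"
      by (simp add: card_cartesian_product)
    also have "\<dots> \<le> card V * ((\<mu>1 + \<mu>2 + \<mu>3) * (q * (M + 1)) ^ 2)"
      using cE by simp
    also have "\<dots> = C * (M + 1) ^ 2"
      unfolding C_def power_mult_distrib by (simp only: mult_ac)
    finally have "card W \<le> C * (M + 1) ^ 2" .
    moreover have "mono3 a b c m \<in> rat_vs.span W" if m: "m \<in> {..M} \<times> {..M} \<times> {..M}" for m
    proof -
      obtain i j k where ijk: "m = (i, j, k)" "i \<le> M" "j \<le> M" "k \<le> M"
        using m by auto
      have "i + B * (j + B * k) \<le> M + B * (M + B * M)"
        using ijk by (intro add_mono mult_left_mono) auto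
      then have "\<omega> m \<le> b'"
        by (simp add: \<omega>_def ijk b'_def q_def algebra_simps)
      then have "1 * mono3 a b c m \<in>
          rat_vs.span ((\<lambda>(v, m). v * mono3 a b c m) ` (V \<times> {m. \<omega> m \<le> b' \<and> m \<notin> range ((+) \<mu>)}))"
        by (intro monomial_reduction[where \<kappa> = \<eta> and N = "S - {\<mu>}"] mono3_add \<omega>_add rel' \<mu>(2) V(3)
            rat_vs.span_base V(2) imageI)
      moreover have "{m. \<omega> m \<le> b' \<and> m \<notin> range ((+) \<mu>)} \<subseteq> E"
      proof clarify
        fix i j k assume w: "\<omega> (i, j, k) \<le> b'" and n: "(i, j, k) \<notin> range ((+) \<mu>)"
        have "1 \<le> B" by (simp add: B_def)
        have "i + B * (j + B * k) \<le> b'" using w by (simp only: \<omega>_def prod.case)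
        moreover have "j + B * k \<le> B * (j + B * k)" "k \<le> B * k"
          using mult_right_mono[OF \<open>1 \<le> B\<close>, of "j + B * k"] mult_right_mono[OF \<open>1 \<le> B\<close>, of k] by simp_all
        ultimately have "i \<le> b'" "j \<le> b'" "k \<le> b'"
          by (metis add_leD1 add_leD2 order_trans)+
        moreover have "i < \<mu>1 \<or> j < \<mu>2 \<or> k < \<mu>3"
        proof (rule ccontr)
          assume "\<not> ?thesis"
          then have "(i, j, k) = \<mu> + (i - \<mu>1, j - \<mu>2, k - \<mu>3)" by (simp add: \<mu>3)
          then show False using n by blast
        qed
        ultimately show "(i, j, k) \<in> E" by (auto simp: E_def)
      qed
      then have "rat_vs.span ((\<lambda>(v, m). v * mono3 a b c m) ` (V \<times> {m. \<omega> m \<le> b' \<and> m \<notin> range ((+) \<mu>)})) \<subseteq> rat_vs.span W"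
        unfolding W_def by (intro rat_vs.span_mono image_mono Sigma_mono) auto
      ultimately show ?thesis by auto
    qed
    ultimately show "\<exists>W. finite W \<and> card W \<le> C * (M + 1) ^ 2 \<and> mono3 a b c ` ({..M} \<times> {..M} \<times> {..M}) \<subseteq> rat_vs.span W"
      using \<open>finite W\<close> by blast
  qed
qed

section \<open>Fractions of polynomials in three numbers\<close>

abbreviation mono3_box :: "complex \<Rightarrow> complex \<Rightarrow> complex \<Rightarrow> nat \<Rightarrow> complex set" where
  "mono3_box a b c M \<equiv> mono3 a b c ` ({..M} \<times> {..M} \<times> {..M})"

lemma span_box_mult:
  assumes "x \<in> rat_vs.span (mono3_box a b c M)" "y \<in> rat_vs.span (mono3_box a b c N)"
  shows "x * y \<in> rat_vs.span (mono3_box a b c (M + N))"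
proof -
  have "(\<lambda>(x, y). x * y) ` (mono3_box a b c M \<times> mono3_box a b c N) \<subseteq> mono3_box a b c (M + N)"
  proof (rule image_subsetI)
    fix p assume "p \<in> mono3_box a b c M \<times> mono3_box a b c N"
    then obtain m n where mn: "m \<in> {..M} \<times> {..M} \<times> {..M}" "n \<in> {..N} \<times> {..N} \<times> {..N}"
      "p = (mono3 a b c m, mono3 a b c n)"
      by blast
    then have "m + n \<in> {..M + N} \<times> {..M + N} \<times> {..M + N}"
      by auto
    then show "(case p of (x, y) \<Rightarrow> x * y) \<in> mono3_box a b c (M + N)"
      unfolding mn(3) prod.case mono3_add[symmetric] by (rule imageI)
  qed
  then show ?thesis
    using span_mult_mem[OF assms] rat_vs.span_mono by blast
qed

lemma mono3_in_box: "i \<le> M \<Longrightarrow> j \<le> M \<Longrightarrow> k \<le> M \<Longrightarrow> a ^ i * b ^ j * c ^ k \<in> rat_vs.span (mono3_box a b c M)"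
  by (rule rat_vs.span_base, rule image_eqI[of _ _ "(i, j, k)"]) (auto simp: mono3_def)

lemma span_box_power:
  assumes "x \<in> rat_vs.span (mono3_box a b c M)"
  shows "x ^ n \<in> rat_vs.span (mono3_box a b c (n * M))"
proof (induction n)
  case 0
  show ?case using mono3_in_box[of 0 0 0 0 a b c] by simp
next
  case (Suc n)
  then show ?case using span_box_mult[OF assms Suc] by simp
qed

text \<open>The fractions with numerator and denominator in a common box form a field containing the
  three generators, hence contain the smallest such field.\<close>

lemma rat_adjoin_fraction:
  assumes "x \<in> rat_adjoin {a, b, c}"
  obtains M f g where "f \<in> rat_vs.span (mono3_box a b c M)" "g \<in> rat_vs.span (mono3_box a b c M)" "g \<noteq> 0" "x = f / g"
proof -
  define K where "K = {f / g | M f g. f \<in> rat_vs.span (mono3_box a b c M) \<and> g \<in> rat_vs.span (mono3_box a b c M) \<and> g \<noteq> 0}"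
  have KI: "f / g \<in> K" if "f \<in> rat_vs.span (mono3_box a b c M)" "g \<in> rat_vs.span (mono3_box a b c M)" "g \<noteq> 0" for f g M
    using that unfolding K_def by blast
  have one: "1 \<in> rat_vs.span (mono3_box a b c M)" for M
    using mono3_in_box[of 0 M 0 0 a b c] by simp
  have poly: "f \<in> K" if "f \<in> rat_vs.span (mono3_box a b c M)" for f M
    using KI[OF that one] by simp
  have "{a, b, c} \<subseteq> K"
    using poly[of a 1] poly[of b 1] poly[of c 1]
      mono3_in_box[of 1 1 0 0 a b c] mono3_in_box[of 0 1 1 0 a b c] mono3_in_box[of 0 1 0 1 a b c] by simp
  moreover have "0 \<in> K" "1 \<in> K"
    using poly[OF rat_vs.span_zero] poly[OF one] by auto
  moreover have "x - y \<in> K \<and> x * y \<in> K" if "x \<in> K" "y \<in> K" for x y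
  proof -
    obtain M f g where 1: "f \<in> rat_vs.span (mono3_box a b c M)" "g \<in> rat_vs.span (mono3_box a b c M)" "g \<noteq> 0" "x = f / g"
      using \<open>x \<in> K\<close> by (auto simp: K_def)
    obtain N f' g' where 2: "f' \<in> rat_vs.span (mono3_box a b c N)" "g' \<in> rat_vs.span (mono3_box a b c N)" "g' \<noteq> 0" "y = f' / g'"
      using \<open>y \<in> K\<close> by (auto simp: K_def)
    note m = span_box_mult[OF 1(1) 2(1)] span_box_mult[OF 1(1) 2(2)] span_box_mult[OF 1(2) 2(1)] span_box_mult[OF 1(2) 2(2)]
    have "x - y = (f * g' - g * f') / (g * g')" "x * y = (f * f') / (g * g')"
      using 1(3) 2(3) unfolding 1(4) 2(4) by (simp_all add: diff_frac_eq mult_ac)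
    then show ?thesis
      using KI[OF rat_vs.span_diff[OF m(2,3)] m(4)] KI[OF m(1,4)] 1 2 by simp
  qed
  moreover have "inverse x \<in> K" if "x \<in> K" for x
  proof -
    obtain M f g where 1: "f \<in> rat_vs.span (mono3_box a b c M)" "g \<in> rat_vs.span (mono3_box a b c M)" "g \<noteq> 0" "x = f / g"
      using \<open>x \<in> K\<close> by (auto simp: K_def)
    then show ?thesis
      using KI[OF 1(2,1)] \<open>0 \<in> K\<close> by (cases "f = 0") (auto simp: field_simps)
  qed
  ultimately have "rat_adjoin {a, b, c} \<subseteq> K"
    unfolding rat_adjoin_def by (intro Inter_lower) blast
  then show ?thesis
    using assms that by (auto simp: K_def)
qed

section \<open>Algebraic independence and the counting bound\<close>

text \<open>Linear dependence is stated for an indexed family, so a repeated value must count as a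
  relation; that case is treated apart from the dependence of the image set.\<close>

lemma rat_dependent_family:
  fixes x :: "'a \<Rightarrow> complex"
  assumes "finite W" "finite I" "card W < card I" and span: "\<And>i. i \<in> I \<Longrightarrow> x i \<in> rat_vs.span W"
  obtains q i where "(\<Sum>i\<in>I. of_rat (q i) * x i) = 0" "i \<in> I" "q i \<noteq> (0 :: rat)"
proof (cases "inj_on x I")
  case False
  then obtain i j where ij: "i \<in> I" "j \<in> I" "i \<noteq> j" "x i = x j"
    by (auto simp: inj_on_def)
  define q :: "'a \<Rightarrow> rat" where "q = (\<lambda>k. if k = i then 1 else if k = j then - 1 else 0)"
  have "(\<Sum>k\<in>I. of_rat (q k) * x k) = (\<Sum>k\<in>{i, j}. of_rat (q k) * x k)"
    using ij \<open>finite I\<close> by (intro sum.mono_neutral_right) (auto simp: q_def)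
  also have "\<dots> = 0" using ij by (simp add: q_def)
  finally show ?thesis using that[of q i] ij by (simp add: q_def)
next
  case True
  have "x ` I \<subseteq> rat_vs.span W" using span by auto
  moreover have "card (x ` I) > card W" using True assms by (simp add: card_image)
  ultimately have "rat_vs.dependent (x ` I)"
    using rat_vs.independent_span_bound[OF \<open>finite W\<close>, of "x ` I"] by linarith
  then obtain u v where u: "(\<Sum>v\<in>x ` I. of_rat (u v) * v) = 0" "v \<in> x ` I" "u v \<noteq> 0"
    using \<open>finite I\<close> by (subst (asm) rat_vs.dependent_finite) auto
  then obtain i where "i \<in> I" "v = x i" by auto
  moreover have "(\<Sum>i\<in>I. of_rat (u (x i)) * x i) = 0"
    using u(1) by (simp add: sum.reindex[OF True])
  ultimately show ?thesis using that[of "\<lambda>i. u (x i)" i] u by simp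
qed

text \<open>The indexed relation is packed into a single polynomial \<open>P\<close>; injectivity of
  \<open>m\<close> ensures that no two coefficients are added together.\<close>

lemma alg_independent_family:
  assumes B: "alg_independent B" and inj: "inj m" and km: "\<And>t. Poly_Mapping.keys (m t) \<subseteq> B"
    and I: "finite I" "(\<Sum>s\<in>I. of_rat (q s) * (\<Prod>b\<in>Poly_Mapping.keys (m s). b ^ Poly_Mapping.lookup (m s) b)) = 0"
      "s \<in> I"
  shows "q s = 0"
proof -
  define P where "P = (\<Sum>t\<in>I. Poly_Mapping.single (m t) (q t))"
  have lP: "Poly_Mapping.lookup P (m t) = q t" if "t \<in> I" for t
  proof -
    have "Poly_Mapping.lookup P (m t) = (\<Sum>x\<in>I. if x = t then q x else 0)"
      unfolding P_def lookup_sum by (intro sum.cong refl) (auto simp: lookup_single when_def dest: injD[OF inj])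
    then show ?thesis using that I(1) by simp
  qed
  have kP: "Poly_Mapping.keys P \<subseteq> m ` I"
  proof
    fix x assume "x \<in> Poly_Mapping.keys P"
    then have "(\<Sum>t\<in>I. Poly_Mapping.lookup (Poly_Mapping.single (m t) (q t)) x) \<noteq> 0"
      by (simp add: P_def in_keys_iff lookup_sum)
    then obtain t where "t \<in> I" "Poly_Mapping.lookup (Poly_Mapping.single (m t) (q t)) x \<noteq> 0"
      by (meson sum.neutral)
    then show "x \<in> m ` I"
      by (auto simp: lookup_single when_def split: if_splits)
  qed
  have "tautological_eval P = (\<Sum>x\<in>m ` I. of_rat (Poly_Mapping.lookup P x) * (\<Prod>b\<in>Poly_Mapping.keys x. b ^ Poly_Mapping.lookup x b))"
    unfolding tautological_eval_def using kP I(1) by (intro sum.mono_neutral_left) (auto simp: in_keys_iff)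
  also have "\<dots> = (\<Sum>t\<in>I. of_rat (q t) * (\<Prod>b\<in>Poly_Mapping.keys (m t). b ^ Poly_Mapping.lookup (m t) b))"
    by (subst sum.reindex) (auto simp: lP intro: inj_on_subset[OF inj])
  finally have "tautological_eval P = 0" using I(2) by simp
  moreover have "\<forall>x\<in>Poly_Mapping.keys P. Poly_Mapping.keys x \<subseteq> B"
    using kP km by blast
  ultimately have "P = 0" using B(1) unfolding alg_independent_def by blast
  then show ?thesis using lP[OF I(3)] by simp
qed

lemma alg_independent_mono3:
  assumes B: "alg_independent B" "u \<in> B" "v \<in> B" "w \<in> B" and ne: "u \<noteq> v" "u \<noteq> w" "v \<noteq> w"
    and I: "finite I" "(\<Sum>s\<in>I. of_rat (q s) * mono3 u v w s) = 0" "s \<in> I"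
  shows "q s = 0"
proof -
  define m where "m = (\<lambda>(i, j, k). Poly_Mapping.single u i + Poly_Mapping.single v j + Poly_Mapping.single w (k::nat))"
  have lm: "Poly_Mapping.lookup (m (i, j, k)) x = (if x = u then i else 0) + (if x = v then j else 0) + (if x = w then k else 0)" for i j k x
    by (auto simp: m_def lookup_add lookup_single when_def)
  have km: "Poly_Mapping.keys (m t) \<subseteq> {u, v, w}" for t
    by (cases t) (auto simp: lm in_keys_iff split: if_splits)
  have inj: "inj m"
  proof (rule injI)
    fix s t assume eq: "m s = m t"
    obtain i j k i' j' k' where st: "s = (i, j, k)" "t = (i', j', k')" by (metis prod_cases3)
    have "Poly_Mapping.lookup (m s) x = Poly_Mapping.lookup (m t) x" for x using eq by simp
    from this[of u] this[of v] this[of w] show "s = t"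
      using ne by (simp add: st lm)
  qed
  have em: "(\<Prod>b\<in>Poly_Mapping.keys (m t). b ^ Poly_Mapping.lookup (m t) b) = mono3 u v w t" for t
  proof -
    have "(\<Prod>b\<in>Poly_Mapping.keys (m t). b ^ Poly_Mapping.lookup (m t) b) = (\<Prod>b\<in>{u, v, w}. b ^ Poly_Mapping.lookup (m t) b)"
      using km by (intro prod.mono_neutral_left) (auto simp: in_keys_iff)
    then show ?thesis
      using ne by (cases t) (simp add: lm mono3_def mult_ac)
  qed
  show ?thesis
    by (rule alg_independent_family[OF B(1) inj _ I(1) _ I(3)]) (use km B I(2) in \<open>auto simp: em\<close>)
qed

lemma alg_independent_not_algebraic:
  assumes B: "alg_independent B" "b \<in> B"
  shows "\<not> algebraic b"
proof
  assume "algebraic b"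
  then obtain p where p: "\<And>i. coeff p i \<in> \<rat>" "p \<noteq> 0" "poly p b = 0"
    by (auto simp: algebraic_altdef)
  then have "\<forall>i. \<exists>r. coeff p i = of_rat r" by (meson Rats_cases)
  then obtain r where r: "\<And>i. coeff p i = of_rat (r i)" by metis
  define m :: "nat \<Rightarrow> complex \<Rightarrow>\<^sub>0 nat" where "m = Poly_Mapping.single b"
  have "inj m"
    by (rule injI) (metis lookup_single_eq m_def)
  moreover have "Poly_Mapping.keys (m i) \<subseteq> B" for i
    using B by (simp add: m_def)
  moreover have "(\<Prod>b\<in>Poly_Mapping.keys (m i). b ^ Poly_Mapping.lookup (m i) b) = b ^ i" for i
    by (cases "i = 0") (simp_all add: m_def)
  moreover have "(\<Sum>i\<in>{..degree p}. of_rat (r i) * b ^ i) = 0"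
    using p(3) by (simp add: poly_altdef r)
  ultimately have "r (degree p) = 0"
    by (intro alg_independent_family[OF B(1), of m "{..degree p}"]) auto
  then show False
    using p(2) r[of "degree p"] by simp
qed

text \<open>Three independent elements with common denominator \<open>g\<close> would give
  \<open>(n + 1)^3\<close> rationally independent products
  \<open>g ^ (3 * n) * mono3 u v w s\<close>. They lie in a box of side linear in \<open>n\<close>,
  whose span has dimension at most quadratic in \<open>n\<close>.\<close>

lemma trdeg_le_2:
  fixes \<kappa> :: "nat \<times> nat \<times> nat \<Rightarrow> complex"
  assumes "finite S" "S \<noteq> {}" "\<And>s. s \<in> S \<Longrightarrow> \<kappa> s \<noteq> 0" "\<And>s. s \<in> S \<Longrightarrow> algebraic (\<kappa> s)"
    and "(\<Sum>s\<in>S. \<kappa> s * mono3 a b c s) = 0"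
  shows "trdeg_rat (rat_adjoin {a, b, c}) \<le> 2"
  unfolding trdeg_rat_def
proof (rule SUP_least)
  fix B assume "B \<in> {B. finite B \<and> B \<subseteq> rat_adjoin {a, b, c} \<and> alg_independent B}"
  then have B: "finite B" "B \<subseteq> rat_adjoin {a, b, c}" "alg_independent B" by auto
  have "\<not> 3 \<le> card B"
  proof
    assume "3 \<le> card B"
    then obtain T where "T \<subseteq> B" "card T = 3"
      using obtain_subset_with_card_n by metis
    then obtain u v w where uvw: "u \<in> B" "v \<in> B" "w \<in> B" "u \<noteq> v" "u \<noteq> w" "v \<noteq> w"
      by (auto simp: card_3_iff)
    obtain M1 f1 g1 where 1: "f1 \<in> rat_vs.span (mono3_box a b c M1)" "g1 \<in> rat_vs.span (mono3_box a b c M1)" "g1 \<noteq> 0" "u = f1 / g1"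
      using rat_adjoin_fraction uvw B by blast
    obtain M2 f2 g2 where 2: "f2 \<in> rat_vs.span (mono3_box a b c M2)" "g2 \<in> rat_vs.span (mono3_box a b c M2)" "g2 \<noteq> 0" "v = f2 / g2"
      using rat_adjoin_fraction uvw B by blast
    obtain M3 f3 g3 where 3: "f3 \<in> rat_vs.span (mono3_box a b c M3)" "g3 \<in> rat_vs.span (mono3_box a b c M3)" "g3 \<noteq> 0" "w = f3 / g3"
      using rat_adjoin_fraction uvw B by blast
    define D where "D = M1 + M2 + M3"
    define g F G H where "g = g1 * g2 * g3" and "F = f1 * g2 * g3" and "G = g1 * f2 * g3" and "H = g1 * g2 * f3"
    have box: "g \<in> rat_vs.span (mono3_box a b c D)" "F \<in> rat_vs.span (mono3_box a b c D)"
      "G \<in> rat_vs.span (mono3_box a b c D)" "H \<in> rat_vs.span (mono3_box a b c D)"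
      unfolding D_def g_def F_def G_def H_def by (intro span_box_mult 1 2 3)+
    have g0: "g \<noteq> 0" and F: "F = u * g" and G: "G = v * g" and H: "H = w * g"
      using 1 2 3 by (simp_all add: g_def F_def G_def H_def)
    obtain C where C: "\<And>M. \<exists>W. finite W \<and> card W \<le> C * (M + 1) ^ 2 \<and> mono3_box a b c M \<subseteq> rat_vs.span W"
      using quadratic_growth[OF assms] by metis
    \<comment> \<open>This value turns the bound \<open>C * (3 * (D + 1) * (n + 1))^2\<close> into
      exactly \<open>n * (n + 1)^2\<close>, just below \<open>(n + 1)^3\<close>.\<close>
    define n where "n = 9 * C * (D + 1) ^ 2"
    obtain W where W: "finite W" "card W \<le> C * (3 * n * D + 1) ^ 2" "mono3_box a b c (3 * n * D) \<subseteq> rat_vs.span W"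
      using C by blast
    define I where "I = {..n} \<times> {..n} \<times> {..n}"
    have "finite I" by (simp add: I_def)
    have cWI: "card W < card I"
    proof -
      have "3 * n * D + 1 \<le> 3 * (D + 1) * (n + 1)" by (simp add: algebra_simps)
      then have "C * (3 * n * D + 1) ^ 2 \<le> C * (3 * (D + 1) * (n + 1)) ^ 2"
        by (intro mult_left_mono power_mono) auto
      also have "\<dots> = (9 * C * (D + 1) ^ 2) * (n + 1) ^ 2"
        by (simp add: power2_eq_square algebra_simps)
      also have "\<dots> = n * (n + 1) ^ 2"
        by (simp only: n_def)
      also have "\<dots> < (n + 1) * (n + 1) ^ 2" by simp
      also have "\<dots> = card I"
        by (simp add: I_def card_cartesian_product power2_eq_square)
      finally show ?thesis using W(2) by simp
    qed
    have "g ^ (3 * n) * mono3 u v w s \<in> rat_vs.span W" if "s \<in> I" for s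
    proof -
      obtain i j k where s: "s = (i, j, k)" "i \<le> n" "j \<le> n" "k \<le> n"
        using \<open>s \<in> I\<close> by (auto simp: I_def)
      \<comment> \<open>Padding with \<open>l\<close> further factors \<open>g\<close> makes every
        product consist of exactly \<open>3 * n\<close> elements of the box of side
        \<open>D\<close>.\<close>
      define l where "l = 3 * n - i - j - k"
      have l: "3 * n = i + j + k + l" using s by (simp add: l_def)
      have "g ^ (3 * n) * mono3 u v w s = F ^ i * G ^ j * H ^ k * g ^ l"
        unfolding l power_add by (simp add: s mono3_def F G H power_mult_distrib mult_ac)
      also have "\<dots> \<in> rat_vs.span (mono3_box a b c (i * D + j * D + k * D + l * D))"
        by (intro span_box_mult span_box_power box)
      also have "i * D + j * D + k * D + l * D = 3 * n * D"
        by (simp only: l add_mult_distrib)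
      finally show ?thesis
        using W(3) rat_vs.span_mono rat_vs.span_span by blast
    qed
    then obtain q s where q: "(\<Sum>s\<in>I. of_rat (q s) * (g ^ (3 * n) * mono3 u v w s)) = 0" "s \<in> I" "q s \<noteq> 0"
      by (rule rat_dependent_family[OF W(1) \<open>finite I\<close> cWI, of "\<lambda>s. g ^ (3 * n) * mono3 u v w s"]) blast+
    have "g ^ (3 * n) * (\<Sum>s\<in>I. of_rat (q s) * mono3 u v w s) = 0"
      using q(1) by (simp add: sum_distrib_left mult_ac)
    then have "(\<Sum>s\<in>I. of_rat (q s) * mono3 u v w s) = 0"
      using g0 by simp
    then show False
      using alg_independent_mono3[OF B(3) uvw, of I q s] q by (simp add: I_def)
  qed
  then have "card B \<le> 2" by simp
  then show "enat (card B) \<le> 2"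
    by (metis enat_ord_simps(1) numeral_eq_enat)
qed

section \<open>Zeros proportional to their exponential\<close>

lemma map_poly_hom_add:
  fixes f :: "'a::comm_ring_1 \<Rightarrow> 'b::comm_ring_1"
  assumes "f 0 = 0" "\<And>x y. f (x + y) = f x + f y"
  shows "map_poly f (p + q) = map_poly f p + map_poly f q"
  by (rule poly_eqI) (simp add: coeff_map_poly assms)

lemma map_poly_hom_mult:
  fixes f :: "'a::comm_ring_1 \<Rightarrow> 'b::comm_ring_1"
  assumes "f 0 = 0" "\<And>x y. f (x + y) = f x + f y" "\<And>x y. f (x * y) = f x * f y"
  shows "map_poly f (p * q) = map_poly f p * map_poly f q"
  by (induction p) (simp_all add: map_poly_pCons map_poly_smult map_poly_hom_add assms)

lemma poly_map_poly_hom: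
  fixes f :: "'a::comm_ring_1 \<Rightarrow> 'b::comm_ring_1"
  assumes "f 0 = 0" "\<And>x y. f (x + y) = f x + f y" "\<And>x y. f (x * y) = f x * f y"
  shows "poly (map_poly f p) (f x) = f (poly p x)"
  by (induction p) (simp_all add: map_poly_pCons assms)

lemmas qbar_hom = zero_qbar.rep_eq plus_qbar.rep_eq times_qbar.rep_eq

lemma complex_of_qbar_eq_0_iff [simp]: "complex_of_qbar x = 0 \<longleftrightarrow> x = 0"
  by (metis complex_of_qbar_inject zero_qbar.rep_eq)

lemma algebraic_complex_of_qbar: "algebraic (complex_of_qbar x)"
  using complex_of_qbar by simp

lemma coeff_complex_poly3:
  "coeff (complex_poly3 p) l = map_poly (map_poly complex_of_qbar) (coeff p l)"
  "coeff (coeff (coeff (complex_poly3 p) l) j) k = complex_of_qbar (coeff (coeff (coeff p l) j) k)"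
  by (simp_all add: complex_poly3_def coeff_map_poly qbar_hom)

lemma poly_eq_sum_bound:
  fixes p :: "'a::comm_ring_1 poly"
  assumes "degree p \<le> N"
  shows "poly p x = (\<Sum>i\<le>N. coeff p i * x ^ i)"
  unfolding poly_altdef using assms by (intro sum.mono_neutral_left) (auto simp: coeff_eq_0)

text \<open>This permits exchanging the substitutions \<open>y = q x\<close> and
  \<open>y = exp a\<close> once \<open>x\<close> is specialised to a number \<open>a\<close> at
  which they agree.\<close>

lemma poly_poly_cong:
  fixes R :: "'a::comm_ring_1 poly poly"
  assumes "poly s a = poly t a"
  shows "poly (poly R s) a = poly (poly R t) a"
  by (induction R) (simp_all add: assms)

lemma eval3_eq_sum:
  fixes P :: "complex poly poly poly"
  assumes "degree P \<le> N"
  shows "eval3 P a b c = (\<Sum>l\<le>N. poly (poly (coeff P l) [:b:]) a * c ^ l)"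
  by (simp add: eval3_def poly_eq_sum_bound[OF assms] poly_sum)

text \<open>The triple lists the exponents of \<open>z\<close>, \<open>y\<close>, \<open>x\<close>
  in this order, so evaluation at \<open>a\<close>, \<open>b\<close>, \<open>c\<close> pairs it with
  \<open>mono3 c b a\<close>.\<close>

definition coeff3 :: "'a::zero poly poly poly \<Rightarrow> nat \<times> nat \<times> nat \<Rightarrow> 'a" where
  "coeff3 P = (\<lambda>(l, j, k). coeff (coeff (coeff P l) j) k)"

lemma degree_bound3:
  fixes P :: "'a::zero poly poly poly"
  obtains N where "degree P \<le> N" "\<And>l. degree (coeff P l) \<le> N" "\<And>l j. degree (coeff (coeff P l) j) \<le> N"
proof -
  have fin: "finite (range (coeff p))" for p :: "'b::zero poly"
    by (rule finite_subset[of _ "insert 0 (coeff p ` {..degree p})"]) (auto simp: image_iff intro: ccontr le_degree)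
  have "finite (\<Union>q\<in>range (coeff P). range (coeff q))"
    by (intro finite_UN_I fin)
  then have "finite (degree ` (\<Union>q\<in>range (coeff P). range (coeff q)) \<union> degree ` range (coeff P) \<union> {degree P})" (is "finite ?D")
    using fin by auto
  then obtain N where N: "\<And>d. d \<in> ?D \<Longrightarrow> d \<le> N"
    unfolding finite_nat_set_iff_bounded_le by blast
  show ?thesis
    by (rule that[of N]; rule N) auto
qed

lemma eval3_mono3:
  fixes P :: "complex poly poly poly"
  shows "finite {s. coeff3 P s \<noteq> 0}"
    and "eval3 P a b c = (\<Sum>s | coeff3 P s \<noteq> 0. coeff3 P s * mono3 c b a s)"
proof -
  obtain N where N: "degree P \<le> N" "\<And>l. degree (coeff P l) \<le> N" "\<And>l j. degree (coeff (coeff P l) j) \<le> N"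
    using degree_bound3[of P] by metis
  have sub: "{s. coeff3 P s \<noteq> 0} \<subseteq> {..N} \<times> {..N} \<times> {..N}"
  proof clarify
    fix l j k assume "coeff3 P (l, j, k) \<noteq> 0"
    then have "k \<le> degree (coeff (coeff P l) j)" "j \<le> degree (coeff P l)" "l \<le> degree P"
      unfolding coeff3_def prod.case by (auto intro!: le_degree)
    then show "l \<in> {..N} \<and> (j, k) \<in> {..N} \<times> {..N}"
      using N(1) N(2)[of l] N(3)[of l j] by simp
  qed
  then show "finite {s. coeff3 P s \<noteq> 0}"
    by (rule finite_subset) simp
  have "eval3 P a b c = (\<Sum>l\<le>N. \<Sum>j\<le>N. \<Sum>k\<le>N. coeff3 P (l, j, k) * mono3 c b a (l, j, k))"
    unfolding eval3_eq_sum[OF N(1)]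
    by (simp add: poly_eq_sum_bound[OF N(2)] poly_eq_sum_bound[OF N(3)] poly_sum sum_distrib_right sum_distrib_left
          coeff3_def mono3_def mult_ac)
  also have "\<dots> = (\<Sum>s\<in>{..N} \<times> {..N} \<times> {..N}. coeff3 P s * mono3 c b a s)"
    by (simp add: sum.cartesian_product case_prod_unfold)
  also have "\<dots> = (\<Sum>s | coeff3 P s \<noteq> 0. coeff3 P s * mono3 c b a s)"
    using sub by (intro sum.mono_neutral_right) auto
  finally show "eval3 P a b c = (\<Sum>s | coeff3 P s \<noteq> 0. coeff3 P s * mono3 c b a s)" .
qed

section \<open>Schanuel's Conjecture for one and two numbers\<close>

text \<open>The case \<open>n = 1\<close> demands transcendence degree at least 1, but if
  \<open>a\<close> and \<open>exp a\<close> were both algebraic they would generate a field of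
  algebraic numbers, in which only the empty set is independent.\<close>

lemma Schanuel_one:
  fixes a :: complex
  assumes "Schanuel_Conjecture" "a \<noteq> 0" "algebraic a"
  shows "\<not> algebraic (exp a)"
proof
  assume "algebraic (exp a)"
  have "inj_on (\<lambda>_. a) {..<1::nat}" by (simp add: inj_on_def)
  moreover have "rat_vs.independent ((\<lambda>_. a) ` {..<1::nat})"
    using assms(2) by (simp add: image_constant_conv lessThan_empty_iff)
  ultimately have "enat 1 \<le> trdeg_rat (rat_adjoin ((\<lambda>_. a) ` {..<1::nat} \<union> (\<lambda>i. exp a) ` {..<1::nat}))"
    using assms(1) unfolding Schanuel_Conjecture_def by blast
  then have "enat 1 \<le> trdeg_rat (rat_adjoin {a, exp a})"
    by (simp add: image_constant_conv lessThan_empty_iff insert_commute)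
  moreover have "rat_adjoin {a, exp a} \<subseteq> {z. algebraic z}"
    unfolding rat_adjoin_def
  proof (rule Inter_lower, clarsimp simp: assms \<open>algebraic (exp a)\<close>, intro conjI allI impI)
    fix x y :: complex assume "algebraic x" "algebraic y"
    then show "algebraic (x - y)" "algebraic (x * y)"
      using algebraic_add[of x "- y"] algebraic_mult by auto
  qed auto
  then have "trdeg_rat (rat_adjoin {a, exp a}) \<le> 0"
    unfolding trdeg_rat_def using alg_independent_not_algebraic
    by (intro SUP_least) (force simp: zero_enat_def)
  ultimately show False
    by (auto simp: zero_enat_def dest: order_trans)
qed

text \<open>The conjecture is applied to \<open>a\<close> and \<open>exp a\<close>; since
  \<open>exp a\<close> is also the exponential of \<open>a\<close>, the four generators reduce to
  three.\<close>

lemma Schanuel_two: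
  fixes a :: complex
  assumes "Schanuel_Conjecture" "a \<noteq> 0" and q: "\<And>q. exp a \<noteq> of_rat q * a"
  shows "2 \<le> trdeg_rat (rat_adjoin {a, exp a, exp (exp a)})"
proof -
  define l where "l = (\<lambda>i::nat. if i = 0 then a else exp a)"
  have two: "{..<2::nat} = {0, 1}" by auto
  have ne: "a \<noteq> exp a" using q[of 1] by auto
  then have "inj_on l {..<2}"
    by (auto simp: two l_def)
  moreover have "rat_vs.independent (l ` {..<2})"
  proof -
    have "a \<notin> rat_vs.span {exp a}"
    proof
      assume "a \<in> rat_vs.span {exp a}"
      then obtain r where r: "a = of_rat r * exp a"
        by (auto simp: rat_vs.span_singleton)
      then have "r \<noteq> 0" using assms(2) by auto
      have "of_rat (inverse r) * a = of_rat (inverse r) * of_rat r * exp a"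
        by (subst (1) r) (simp only: mult.assoc)
      also have "of_rat (inverse r) * of_rat r = (1 :: complex)"
        using \<open>r \<noteq> 0\<close> by (simp flip: of_rat_mult)
      finally have "exp a = of_rat (inverse r) * a" by simp
      then show False using q by blast
    qed
    then have "rat_vs.independent {a, exp a}"
      by (intro rat_vs.independent_insertI) (auto simp: rat_vs.independent_empty)
    then show ?thesis by (simp add: two l_def insert_commute)
  qed
  ultimately have "enat 2 \<le> trdeg_rat (rat_adjoin (l ` {..<2} \<union> (\<lambda>i. exp (l i)) ` {..<2}))"
    using assms(1) unfolding Schanuel_Conjecture_def by blast
  also have "l ` {..<2} \<union> (\<lambda>i. exp (l i)) ` {..<2} = {a, exp a, exp (exp a)}"
    by (auto simp: two l_def)
  finally show ?thesis by (simp add: numeral_eq_enat)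
qed

section \<open>Consequences of irreducibility\<close>

text \<open>The cofactor carries the positive \<open>z\<close>-degree and is no unit, so the divisor
  \<open>d\<close>, which is free of \<open>z\<close>, must be one and hence has
  \<open>y\<close>-degree 0.\<close>

lemma irreducible_not_divisible_by_const:
  fixes p :: "'a::field poly poly poly"
  assumes "irreducible p" "degree p > 0" "[:d:] dvd p"
  shows "degree d = 0"
proof -
  obtain r where r: "p = [:d:] * r" using assms(3) by auto
  then have "[:d:] dvd 1 \<or> r dvd 1"
    using assms(1) irreducibleD by blast
  moreover have "\<not> r dvd 1"
  proof
    assume "r dvd 1"
    then obtain c where "r = [:c:]" by (auto simp: is_unit_poly_iff)
    then have "p = [:d * c:]" using r by simp
    then show False using assms(2) by (metis degree_pCons_0 less_irrefl)
  qed
  ultimately have "d dvd 1" by (simp add: is_unit_const_poly_iff)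
  then show ?thesis by (auto simp: is_unit_poly_iff)
qed

text \<open>Otherwise \<open>p\<close> is a power of \<open>z\<close> times its leading coefficient;
  irreducibility leaves only a constant multiple of \<open>z\<close>, which does not involve
  \<open>x\<close>.\<close>

lemma irreducible_two_z_powers:
  fixes p :: "'a::field poly poly poly"
  assumes "irreducible p" "depends_on_x p" "degree p > 0"
  obtains l where "l \<noteq> degree p" "coeff p l \<noteq> 0"
proof (rule ccontr)
  assume "\<not> thesis"
  then have z: "coeff p l = 0" if "l \<noteq> degree p" for l
    using that \<open>\<And>l. l \<noteq> degree p \<Longrightarrow> coeff p l \<noteq> 0 \<Longrightarrow> thesis\<close> by blast
  then have "p = monom (lead_coeff p) (degree p)"
    by (intro poly_eqI) (auto simp: coeff_monom)
  then have p: "p = [:0, 1:] * monom (lead_coeff p) (degree p - 1)"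
    using assms(3) by (cases "degree p") (auto simp: monom_Suc)
  have "\<not> [:0, 1:] dvd (1 :: 'a poly poly poly)"
    by (auto simp: is_unit_poly_iff)
  then have "monom (lead_coeff p) (degree p - 1) dvd 1"
    using irreducibleD[OF assms(1) p] by blast
  then obtain c where c: "monom (lead_coeff p) (degree p - 1) = [:c:]" "c dvd 1"
    by (auto simp: is_unit_poly_iff)
  then obtain e where e: "c = [:[:e:]:]"
    by (auto simp: is_unit_poly_iff)
  have "p = [:0, 1:] * [:[:[:e:]:]:]"
    using p c(1) e by metis
  then have "degree (coeff (coeff p l) m) = 0" for l m
    by (simp add: coeff_pCons split: nat.split)
  then show False
    using assms(2) by (simp add: depends_on_x_def)
qed


section \<open>Lower bound for a rational ratio of \<open>exp a\<close> to \<open>a\<close>\<close>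

text \<open>Modulo \<open>n\<close> the factor \<open>m\<close> is invertible and \<open>l\<close>,
  \<open>l'\<close> differ by less than \<open>n\<close>, so they agree. The shift by
  \<open>|m| * D\<close> keeps the exponents nonnegative for negative \<open>m\<close>, so
  \<open>nat\<close> loses nothing.\<close>

lemma residue_exponents_inj:
  fixes D i i' l l' n :: nat and m :: int
  assumes "D < n" "l \<le> D" "l' \<le> D" "coprime m (int n)"
    and eq: "i * n + nat (\<bar>m\<bar> * D + m * l) = i' * n + nat (\<bar>m\<bar> * D + m * l')"
  shows "i = i' \<and> l = l'"
proof -
  have nonneg: "0 \<le> \<bar>m\<bar> * int D + m * int k" if "k \<le> D" for k
  proof -
    have "- (m * int k) \<le> \<bar>m\<bar> * int k"
      by (metis abs_ge_minus_self abs_mult abs_of_nat)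
    also have "\<dots> \<le> \<bar>m\<bar> * int D"
      using that by (intro mult_left_mono) auto
    finally show ?thesis by simp
  qed
  have "int (i * n + nat (\<bar>m\<bar> * D + m * l)) = int (i' * n + nat (\<bar>m\<bar> * D + m * l'))"
    using eq by simp
  then have e: "int i * int n + m * int l = int i' * int n + m * int l'"
    using nonneg[OF assms(2)] nonneg[OF assms(3)] by simp
  then have "m * (int l - int l') = int n * (int i' - int i)"
    by (simp add: algebra_simps)
  then have "int n dvd m * (int l - int l')" by simp
  then have "int n dvd int l - int l'"
    using assms(4) by (simp add: coprime_commute coprime_dvd_mult_right_iff)
  then have "l = l'"
    using assms(1-3) zdvd_imp_le[of "int n" "\<bar>int l - int l'\<bar>"] by (cases "l = l'") auto
  then show ?thesis
    using e assms(1) by simp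
qed

text \<open>
  With \<open>s = exp (a / n)\<close> and \<open>q = m / n\<close>, all of \<open>a = s ^ n / q\<close>, \<open>exp a = s ^ n\<close> and
  \<open>exp (exp a) = s powi m\<close> are powers of \<open>s\<close>. As \<open>s\<close> is transcendental and \<open>m\<close> is prime to \<open>n\<close>,
  the coefficients of the different powers of \<open>z\<close>, of which there are fewer than \<open>n\<close>,
  contribute exponents in different residue classes modulo \<open>n\<close> and so vanish separately.
\<close>

lemma proportional_zero_imp_slope:
  fixes p :: "qbar poly poly poly" and a :: complex and q :: rat
  assumes Sch: "Schanuel_Conjecture" and p: "irreducible p" "depends_on_z p"
    and zero: "eval3 (complex_poly3 p) a (exp a) (exp (exp a)) = 0"
    and a: "a \<noteq> 0" "exp a = of_rat q * a"
  shows "1 \<le> \<bar>q\<bar> * of_nat (degree p)"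
proof (rule ccontr)
  assume small: "\<not> 1 \<le> \<bar>q\<bar> * of_nat (degree p)"
  define D where "D = degree p"
  have "q \<noteq> 0" using a by auto
  obtain m n' where mn': "quotient_of q = (m, n')" by (cases "quotient_of q")
  define n where "n = nat n'"
  have n': "n' = int n" "n > 0" "coprime m (int n)"
    using quotient_of_denom_pos[OF mn'] quotient_of_coprime[OF mn'] by (simp_all add: n_def)
  have q: "q = of_int m / of_nat n"
    using quotient_of_div[OF mn'] n' by simp
  then have "m \<noteq> 0" using \<open>q \<noteq> 0\<close> by auto
  \<comment> \<open>In lowest terms \<open>|q| = |m| / n\<close> with \<open>|m|\<close> at least 1,
    so \<open>|q| * D < 1\<close> forces \<open>D < n\<close>.\<close>
  have "D < n"
  proof (rule ccontr)
    assume "\<not> D < n"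
    then have "rat_of_nat n \<le> of_nat D" by simp
    moreover have "1 \<le> \<bar>rat_of_int m\<bar>"
      using \<open>m \<noteq> 0\<close> by (simp flip: of_int_abs)
    ultimately have "1 * rat_of_nat n \<le> \<bar>of_int m\<bar> * of_nat D"
      by (intro mult_mono) auto
    then show False
      using small n' by (simp add: q D_def abs_divide field_simps)
  qed
  define s where "s = exp (a / of_nat n)"
  have sn: "s ^ n = exp a"
    using n' by (simp add: s_def flip: exp_of_nat_mult)
  have s0: "s \<noteq> 0" by (simp add: s_def)
  have sm: "s powi (m * int l) = exp (exp a) ^ l" for l
  proof -
    have "s powi m = exp (of_int m * (a / of_nat n))"
      unfolding s_def by (simp add: exp_power_int)
    also have "of_int m * (a / of_nat n) = exp a"
      using a(2) by (simp add: q of_rat_divide)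
    finally have "s powi m = exp (exp a)" .
    then show ?thesis by (simp add: power_int_mult)
  qed
  have transc: "\<not> algebraic s"
  proof
    assume "algebraic s"
    have "algebraic (s ^ k)" for k
      by (induction k) (auto intro: algebraic_mult \<open>algebraic s\<close>)
    then have "algebraic (exp a)" using sn by metis
    moreover have "a = exp a / of_rat q"
      using a(2) \<open>q \<noteq> 0\<close> by simp
    then have "algebraic a"
      by (metis \<open>algebraic (exp a)\<close> algebraic_divide_complex rat_imp_algebraic Rats_of_rat)
    ultimately show False
      using Schanuel_one[OF Sch a(1)] by blast
  qed
  define q' where "q' = Abs_qbar (of_rat q)"
  have q': "complex_of_qbar q' = of_rat q"
    unfolding q'_def by (rule Abs_qbar_inverse) (simp add: rat_imp_algebraic)
  \<comment> \<open>The substitution \<open>y = q x\<close> is made with \<open>x\<close> still a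
    variable, so that vanishing of all \<open>u l\<close> becomes a divisibility statement about
    \<open>p\<close>.\<close>
  define u where "u = (\<lambda>l. poly (coeff p l) [:0, q':])"
  define F where "F = map_poly complex_of_qbar"
  have F: "F 0 = 0" "F (x + y) = F x + F y" "F (x * y) = F x * F y" for x y
    unfolding F_def by (simp_all add: map_poly_hom_add map_poly_hom_mult qbar_hom)
  have Fq': "F [:0, q':] = [:0, of_rat q:]"
    by (simp add: F_def map_poly_pCons qbar_hom q')
  have Fu: "poly (F (u l)) a = poly (poly (coeff (complex_poly3 p) l) [:exp a:]) a" for l
  proof -
    have "F (u l) = poly (map_poly F (coeff p l)) (F [:0, q':])"
      unfolding u_def by (rule poly_map_poly_hom[symmetric, OF F])
    also have "poly \<dots> a = poly (poly (map_poly F (coeff p l)) [:exp a:]) a"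
      by (rule poly_poly_cong) (simp add: Fq' a(2))
    finally show ?thesis
      by (simp add: coeff_complex_poly3 F_def)
  qed
  define N where "N = (\<Sum>l\<le>D. degree (F (u l)))"
  have N: "degree (F (u l)) \<le> N" if "l \<le> D" for l
    unfolding N_def using that by (intro member_le_sum) auto
  define e where "e = (\<lambda>l::nat. nat (\<bar>m\<bar> * D + m * l))"
  have e: "s ^ e l = s ^ (nat \<bar>m\<bar> * D) * exp (exp a) ^ l" if "l \<le> D" for l
  proof -
    have "- (m * int l) \<le> \<bar>m\<bar> * int l"
      by (metis abs_ge_minus_self abs_mult abs_of_nat)
    also have "\<dots> \<le> \<bar>m\<bar> * int D"
      using that by (intro mult_left_mono) auto
    finally have el: "int (e l) = int (nat \<bar>m\<bar> * D) + m * int l"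
      by (simp add: e_def)
    have "s powi int (e l) = s powi int (nat \<bar>m\<bar> * D) * s powi (m * int l)"
      unfolding el by (rule power_int_add) (simp add: s0)
    then show ?thesis by (simp only: power_int_of_nat sm)
  qed
  define c where "c = (\<lambda>(l, i). coeff (F (u l)) i / of_rat q ^ i)"
  define H where "H = (\<Sum>(l, i)\<in>{..D} \<times> {..N}. monom (c (l, i)) (i * n + e l))"
  have "poly H s = (\<Sum>l\<le>D. \<Sum>i\<le>N. c (l, i) * s ^ (i * n + e l))"
    by (simp add: H_def poly_sum poly_monom case_prod_unfold sum.cartesian_product)
  also have "\<dots> = (\<Sum>l\<le>D. (\<Sum>i\<le>N. coeff (F (u l)) i * a ^ i) * s ^ e l)"
    unfolding sum_distrib_right
  proof (intro sum.cong refl)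
    fix l i
    have "s ^ (i * n + e l) = (of_rat q * a) ^ i * s ^ e l"
      unfolding a(2)[symmetric] sn[symmetric] by (simp add: power_add mult.commute flip: power_mult)
    then show "c (l, i) * s ^ (i * n + e l) = coeff (F (u l)) i * a ^ i * s ^ e l"
      using \<open>q \<noteq> 0\<close> by (simp add: c_def power_mult_distrib)
  qed
  also have "\<dots> = (\<Sum>l\<le>D. s ^ (nat \<bar>m\<bar> * D) * (poly (F (u l)) a * exp (exp a) ^ l))"
    by (intro sum.cong refl) (simp add: poly_eq_sum_bound[OF N] e)
  also have "\<dots> = s ^ (nat \<bar>m\<bar> * D) * eval3 (complex_poly3 p) a (exp a) (exp (exp a))"
    unfolding Fu sum_distrib_left[symmetric]
    by (subst eval3_eq_sum[of _ D]) (simp_all add: complex_poly3_def D_def map_poly_degree_leq)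
  finally have "poly H s = 0" using zero by simp
  have alg: "algebraic (c x)" for x
  proof -
    have "algebraic (of_rat q ^ i :: complex)" for i
      by (metis of_rat_power rat_imp_algebraic Rats_of_rat)
    then show ?thesis
      unfolding c_def F_def
      by (cases x) (auto simp: coeff_map_poly qbar_hom intro!: algebraic_divide_complex algebraic_complex_of_qbar)
  qed
  have algH: "algebraic (coeff H k)" for k
  proof -
    have "algebraic (\<Sum>x\<in>I. g x)" if "\<And>x. algebraic (g x)" for I :: "(nat \<times> nat) set" and g :: "_ \<Rightarrow> complex"
      by (induction I rule: infinite_finite_induct) (auto intro: algebraic_add that)
    then show ?thesis
      unfolding H_def coeff_sum using alg by (auto simp: case_prod_unfold coeff_monom)
  qed
  \<comment> \<open>\<open>H\<close> has algebraic coefficients and the transcendental root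
    \<open>s\<close>. As its exponents are pairwise distinct, each \<open>c (l, i)\<close> is then a
    coefficient of the zero polynomial.\<close>
  have "H = 0"
    using algebraic_if_root[OF _ \<open>poly H s = 0\<close> algH] transc by blast
  have "c (l, i) = 0" if "l \<le> D" "i \<le> N" for l i
  proof -
    have "coeff H (i * n + e l) = (\<Sum>x\<in>{..D} \<times> {..N}. if x = (l, i) then c x else 0)"
      unfolding H_def coeff_sum
    proof (intro sum.cong refl)
      fix x assume "x \<in> {..D} \<times> {..N}"
      then obtain l' i' where x: "x = (l', i')" "l' \<le> D" by auto
      have "i' * n + e l' = i * n + e l \<longleftrightarrow> i' = i \<and> l' = l"
        using residue_exponents_inj[OF \<open>D < n\<close> x(2) that(1) n'(3), of i' i] by (auto simp only: e_def)
      then show "coeff (case x of (l, i) \<Rightarrow> monom (c (l, i)) (i * n + e l)) (i * n + e l) = (if x = (l, i) then c x else 0)"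
        by (auto simp only: x prod.case coeff_monom prod.inject split: if_split)
    qed
    then show ?thesis using that \<open>H = 0\<close> by simp
  qed
  then have cz: "coeff (F (u l)) i = 0" if "l \<le> D" "i \<le> N" for l i
    using that \<open>q \<noteq> 0\<close> by (auto simp: c_def)
  have "F (u l) = 0" if "l \<le> D" for l
    using cz[OF that N[OF that]] by simp
  then have u1: "u l = 0" if "l \<le> D" for l
    using that unfolding F_def by (simp add: map_poly_eq_0_iff qbar_hom)
  \<comment> \<open>All \<open>z\<close>-coefficients vanish on \<open>y = q x\<close>, so
    \<open>p\<close> has the \<open>z\<close>-free divisor \<open>y - q x\<close> of
    \<open>y\<close>-degree 1.\<close>
  have "poly (coeff p l) [:0, q':] = 0" for l
  proof (cases "l \<le> D")
    case True
    then show ?thesis using u1[of l] by (simp add: u_def)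
  qed (simp add: D_def coeff_eq_0)
  then have "[:[:- [:0, q':], 1:]:] dvd p"
    by (simp add: const_poly_dvd_iff poly_eq_0_iff_dvd)
  then have "degree [:- [:0, q':], 1:] = 0"
    using irreducible_not_divisible_by_const p unfolding depends_on_z_def by blast
  then show False by simp
qed

section \<open>Existence of the generic zero\<close>

lemma norm_of_rat_complex: "cmod (of_rat q) = real_of_rat \<bar>q\<bar>"
  by (cases q) (simp add: of_rat_rat norm_divide)

theorem theorem4p2:
  fixes p :: "qbar poly poly poly"
  assumes "Schanuel_Conjecture"
    and "irreducible p"
    and "depends_on_x p" and "depends_on_z p"
    and "\<not> (\<exists>(c::complex) m l. complex_poly3 p = monom (monom [:c:] m) l)"
  shows "\<exists>a::complex. eval3 (complex_poly3 p) a (exp a) (exp (exp a)) = 0 \<and>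
           trdeg_rat (rat_adjoin {a, exp a, exp (exp a)}) = 2"
proof -
  define P where "P = complex_poly3 p"
  define S where "S = {s. coeff3 P s \<noteq> 0}"
  have P: "coeff3 P s = complex_of_qbar (coeff3 p s)" for s
    by (cases s) (simp add: P_def coeff3_def coeff_complex_poly3(2))
  have deg: "degree p > 0" using assms(4) by (simp add: depends_on_z_def)
  \<comment> \<open>Two different powers of \<open>z\<close> supply the two terms with distinct
    \<open>L\<close> that the Newton edge needs.\<close>
  obtain l where l: "l \<noteq> degree p" "coeff p l \<noteq> 0"
    using irreducible_two_z_powers[OF assms(2,3) deg] .
  have in_S: "\<exists>j k. (l, j, k) \<in> S" if nz: "coeff p l \<noteq> 0" for l
  proof -
    obtain j k where "coeff (coeff (coeff p l) j) k \<noteq> 0"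
      using nz by (metis coeff_0 poly_eqI)
    then have "coeff3 p (l, j, k) \<noteq> 0" by (simp add: coeff3_def)
    then show ?thesis by (auto simp: S_def P)
  qed
  obtain j k where s1: "(l, j, k) \<in> S"
    using in_S[OF l(2)] by blast
  have "lead_coeff p \<noteq> 0" using deg by auto
  then obtain j' k' where s2: "(degree p, j', k') \<in> S"
    using in_S by blast
  \<comment> \<open>If \<open>exp a = q * a\<close>, then \<open>|q|\<close> is at least this
    \<open>\<delta>\<close>; a zero with \<open>|exp a| < \<delta> * |a|\<close> therefore escapes
    every rational ratio.\<close>
  define \<delta> where "\<delta> = 1 / real (degree p)"
  have "\<delta> > 0" using deg by (simp add: \<delta>_def)
  obtain a where a: "(\<Sum>s\<in>S. coeff3 P s * a ^ snd (snd s) * exp a ^ fst (snd s) * exp (exp a) ^ fst s) = 0"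
    "cmod (exp a) < \<delta> * cmod a"
  proof (rule zeros_far_out[of S "\<lambda>s. snd (snd s)" "\<lambda>s. fst (snd s)" fst "coeff3 P" "(l, j, k)"
        "(degree p, j', k')" \<delta>])
    show "inj_on (\<lambda>s. (snd (snd s), fst (snd s), fst s)) S"
      by (auto simp: inj_on_def)
    show "finite S" unfolding S_def by (rule eval3_mono3)
    show "coeff3 P s \<noteq> 0" if "s \<in> S" for s using that by (simp add: S_def)
  qed (use s1 s2 l(1) \<open>\<delta> > 0\<close> in simp_all)
  have sum0: "(\<Sum>s\<in>S. coeff3 P s * mono3 (exp (exp a)) (exp a) a s) = 0"
    using a(1) by (simp add: mono3_def case_prod_unfold mult_ac)
  then have zero: "eval3 P a (exp a) (exp (exp a)) = 0"
    unfolding S_def by (simp add: eval3_mono3(2))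
  have "a \<noteq> 0" using a(2) by auto
  have "exp a \<noteq> of_rat q * a" for q
  proof
    assume q: "exp a = of_rat q * a"
    have "1 \<le> \<bar>q\<bar> * of_nat (degree p)"
      using proportional_zero_imp_slope[OF assms(1,2,4) _ \<open>a \<noteq> 0\<close> q] zero by (simp add: P_def)
    then have "real_of_rat 1 \<le> of_rat (\<bar>q\<bar> * of_nat (degree p))"
      by (simp only: of_rat_less_eq)
    then have "1 \<le> real_of_rat \<bar>q\<bar> * real (degree p)"
      by (simp only: of_rat_mult of_rat_1 of_rat_of_nat_eq)
    then have "\<delta> \<le> real_of_rat \<bar>q\<bar>"
      using deg by (simp add: \<delta>_def divide_le_eq)
    then have "\<delta> * cmod a \<le> real_of_rat \<bar>q\<bar> * cmod a"
      by (rule mult_right_mono) simp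
    also have "\<dots> = cmod (exp a)"
      unfolding q norm_mult norm_of_rat_complex ..
    finally show False
      using a(2) by linarith
  qed
  then have "2 \<le> trdeg_rat (rat_adjoin {a, exp a, exp (exp a)})"
    using Schanuel_two[OF assms(1) \<open>a \<noteq> 0\<close>] by blast
  \<comment> \<open>The polynomial \<open>p\<close> itself is the algebraic relation behind the
    upper bound; the generators are listed in the order of the exponent triples.\<close>
  moreover have "trdeg_rat (rat_adjoin {exp (exp a), exp a, a}) \<le> 2"
  proof (rule trdeg_le_2[of S "coeff3 P"])
    show "S \<noteq> {}" using s1 by auto
    show "finite S" unfolding S_def by (rule eval3_mono3)
    show "(\<Sum>s\<in>S. coeff3 P s * mono3 (exp (exp a)) (exp a) a s) = 0" by (rule sum0)
    show "algebraic (coeff3 P s)" for s unfolding P by (rule algebraic_complex_of_qbar)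
  qed (simp add: S_def)
  moreover have "{exp (exp a), exp a, a} = {a, exp a, exp (exp a)}" by auto
  ultimately have "trdeg_rat (rat_adjoin {a, exp a, exp (exp a)}) = 2"
    by (metis antisym)
  then show ?thesis
    using zero unfolding P_def by blast
qed

end
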